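(* Let $0<\beta<1$ and $T>0$. For every $p,q\ge1$, the operator $$\nabla_1:\mathcal{F}C_b^\infty\longrightarrow L^p\big(\mathbb{W}\times\mathbb{R}^+,\mathcal{F}^{X_{\beta,T}},\mathbb{P}_{1/2}\otimes\mathbb{P}_{Y_\beta};\mathcal{H}_{1/2}\big)$$ is closable in $L^q(\mathbb{W}\times\mathbb{R}^+,\mathcal{F}^{X_{\beta,T}},\mathbb{P}_{1/2}\otimes\mathbb{P}_{Y_\beta})$; that is, if $(F_n)_{n\in\mathbb{N}}\subset\mathcal{F}C_b^\infty$ satisfies $F_n\to0$ in $L^q$ and $\nabla_1F_n\to Z$ in $L^p(\,\cdot\,;\mathcal{H}_{1/2})$, then $Z=0$.
   Context: $\mathbb{R}^+=[0,\infty)$. $\mathbb{W}$ is the space of continuous $w:\mathbb{R}^+\to\mathbb{R}$ with $w(0)=0$, with the topology of locally uniform convergence; $\mathbb{P}_{1/2}$ is Wiener measure on $\mathbb{W}$. $\mathbb{P}_{Y_\beta}$ is the probability measure on $\mathbb{R}^+$ with density $M_\beta$ determined by $\int_0^\infty e^{-s\tau}M_\beta(\tau)\,d\tau=E_\beta(-s)$, $s\ge0$, with $E_\beta(z)=\sum_{n\ge0}z^n/\Gamma(\beta n+1)$. Put $X_{\beta,T}(t)(w,\tau)=w(t\tau)$ for $t\in[0,T]$ and $\mathcal{F}^{X_{\beta,T}}=\sigma(X_{\beta,T}(t),t\in[0,T])$. Elements of $L^p$ spaces are identified when equal $\mathbb{P}_{1/2}\otimes\mathbb{P}_{Y_\beta}$-a.s.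 $\mathcal{H}_{1/2}$ is the Hilbert space of functions $h(t)=\int_0^t\dot h(s)\,\mathrm{d}s$ with $\dot h\in L^2(\mathbb{R}^+)$ (Lebesgue measure), with $(h,g)_{\mathcal{H}_{1/2}}=\int_0^\infty\dot h(s)\dot g(s)\,\mathrm{d}s$. $\mathcal{F}C_b^\infty$ (depending on $T$) is the class of functions $F(w,\tau)=f(w(t_1\tau),\dots,w(t_n\tau))$ on $\mathbb{W}\times\mathbb{R}^+$ with $n\in\mathbb{N}$, $0<t_1<\dots<t_n\le T$ and $f\in C_b^\infty(\mathbb{R}^n)$, the set of $C^\infty$ real-valued functions bounded together with all their partial derivatives. For such $F$ and $h\in\mathcal{H}_{1/2}$, $(\partial_{1,h}F)(w,\tau)=\lim_{\varepsilon\to0}\varepsilon^{-1}(F(w+\varepsilon h,\tau)-F(w,\tau))=\sum_i\partial_if(w(t_1\tau),\dots,w(t_n\tau))h(t_i\tau)$, and the gradient $\nabla_1F(w,\tau)\in\mathcal{H}_{1/2}$ is the unique element with $(\partial_{1,h}F)(w,\tau)=(\nabla_1F(w,\tau),h)_{\mathcal{H}_{1/2}}$ for all $h\in\mathcal{H}_{1/2}$; explicitly $(\nabla_1F(w,\tau))(t)=\sum_i\partial_if(w(t_1\tau),\dots,w(t_n\tau))\,(t\wedge t_i\tau)$. *)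

theory Defs
  imports "HOL-Probability.Probability"
begin

section \<open>The path space\<close>

text \<open>A path on \<open>[0,\<infinity>)\<close> is represented by its extension by \<open>0\<close> to the negative half-line,
  so that equality of paths is equality of functions.\<close>

typedef path = "{w :: real \<Rightarrow> real. continuous_on {0..} w \<and> w 0 = 0 \<and> (\<forall>t<0. w t = 0)}"
  morphisms path_fun Abs_path
  by (rule exI[of _ "\<lambda>_. 0"]) simp

setup_lifting type_definition_path

instantiation path :: real_vector
begin

lift_definition zero_path :: path is "\<lambda>_. 0" by simp
lift_definition plus_path :: "path \<Rightarrow> path \<Rightarrow> path" is "\<lambda>v w t. v t + w t"
  by (auto intro: continuous_intros)
lift_definition uminus_path :: "path \<Rightarrow> path" is "\<lambda>w t. - w t"
  by (auto intro: continuous_intros)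
lift_definition minus_path :: "path \<Rightarrow> path \<Rightarrow> path" is "\<lambda>v w t. v t - w t"
  by (auto intro: continuous_intros)
lift_definition scaleR_path :: "real \<Rightarrow> path \<Rightarrow> path" is "\<lambda>c w t. c * w t"
  by (auto intro: continuous_intros)

instance
  by standard (transfer; auto simp: algebra_simps)+

end

instantiation path :: topological_space
begin

text \<open>Locally uniform convergence: the uniform balls over the intervals \<open>[0,K]\<close> form a
  neighbourhood base.\<close>

definition open_path :: "path set \<Rightarrow> bool" where
  "open_path U \<longleftrightarrow>
     (\<forall>w\<in>U. \<exists>K\<ge>0. \<exists>e>0. \<forall>v. (\<forall>t\<in>{0..K}. \<bar>path_fun v t - path_fun w t\<bar> < e) \<longrightarrow> v \<in> U)"

instance
proof
  show "open (UNIV :: path set)"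
    by (auto simp: open_path_def intro!: exI[of _ 0] exI[of _ 1])
next
  fix S T :: "path set" assume S: "open S" and T: "open T"
  show "open (S \<inter> T)"
    unfolding open_path_def
  proof
    fix w assume "w \<in> S \<inter> T"
    obtain K e where 1: "K \<ge> 0" "e > 0"
      "\<And>v. (\<forall>t\<in>{0..K}. \<bar>path_fun v t - path_fun w t\<bar> < e) \<Longrightarrow> v \<in> S"
      using S \<open>w \<in> S \<inter> T\<close> unfolding open_path_def by (metis IntD1)
    obtain L d where 2: "L \<ge> 0" "d > 0"
      "\<And>v. (\<forall>t\<in>{0..L}. \<bar>path_fun v t - path_fun w t\<bar> < d) \<Longrightarrow> v \<in> T"
      using T \<open>w \<in> S \<inter> T\<close> unfolding open_path_def by (metis IntD2)
    have "v \<in> S \<inter> T" if "\<forall>t\<in>{0..max K L}. \<bar>path_fun v t - path_fun w t\<bar> < min e d" for v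
      using that by (intro IntI 1(3) 2(3)) auto
    with 1 2 show "\<exists>K\<ge>0. \<exists>e>0. \<forall>v. (\<forall>t\<in>{0..K}. \<bar>path_fun v t - path_fun w t\<bar> < e) \<longrightarrow> v \<in> S \<inter> T"
      by (intro exI[of _ "max K L"] conjI exI[of _ "min e d"]) auto
  qed
next
  fix K :: "path set set" assume "\<forall>S\<in>K. open S"
  then show "open (\<Union>K)"
    unfolding open_path_def by (meson UnionE UnionI)
qed

end

text \<open>Stationary independent Gaussian increments fix the finite-dimensional distributions, so at
  most one measure satisfies this predicate.\<close>

definition wiener_measure :: "path measure \<Rightarrow> bool" where
  "wiener_measure P \<longleftrightarrow>
     sets P = sets borel \<and> prob_space P \<and>
     (\<forall>s t. 0 \<le> s \<longrightarrow> s < t \<longrightarrow>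
        distributed P lborel (\<lambda>w. path_fun w t - path_fun w s) (normal_density 0 (sqrt (t - s)))) \<and>
     (\<forall>(n::nat) t. 0 \<le> t 0 \<longrightarrow> strict_mono_on {..n} t \<longrightarrow>
        prob_space.indep_vars P (\<lambda>_. borel) (\<lambda>i w. path_fun w (t (Suc i)) - path_fun w (t i)) {..<n})"

section \<open>The Cameron--Martin space\<close>

definition square_integrable :: "(real \<Rightarrow> real) \<Rightarrow> bool" where
  "square_integrable d \<longleftrightarrow>
     set_borel_measurable lborel {0..} d \<and> set_integrable lborel {0..} (\<lambda>s. (d s)\<^sup>2)"

definition L2_derivative :: "path \<Rightarrow> (real \<Rightarrow> real) \<Rightarrow> bool" where
  "L2_derivative h d \<longleftrightarrow>
     square_integrable d \<and> (\<forall>t\<ge>0. path_fun h t = (LBINT s:{0..t}. d s))"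

lemma square_integrable_add:
  assumes "square_integrable d" "square_integrable e"
  shows "square_integrable (\<lambda>s. d s + e s)"
proof -
  have m [measurable]: "(\<lambda>s. indicator {0..} s * d s) \<in> borel_measurable lborel"
      "(\<lambda>s. indicator {0..} s * e s) \<in> borel_measurable lborel"
    using assms by (auto simp: square_integrable_def set_borel_measurable_def)
  have "(\<lambda>s. indicator {0..} s * d s + indicator {0..} s * e s) \<in> borel_measurable lborel"
    by measurable
  then have 1: "(\<lambda>s. indicator {0..} s * (d s + e s)) \<in> borel_measurable lborel"
    by (simp add: distrib_left)
  have "integrable lborel (\<lambda>s. 2 * (indicator {0..} s * (d s)\<^sup>2) + 2 * (indicator {0..} s * (e s)\<^sup>2))"
    using assms by (auto simp: square_integrable_def set_integrable_def)
  then have 2: "integrable lborel (\<lambda>s. indicator {0..} s * (d s + e s)\<^sup>2)"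
  proof (rule Bochner_Integration.integrable_bound)
    have "(\<lambda>s. (indicator {0..} s * (d s + e s))\<^sup>2) \<in> borel_measurable lborel"
      using 1 by measurable
    then show "(\<lambda>s. indicator {0..} s * (d s + e s)\<^sup>2) \<in> borel_measurable lborel"
      by (rule measurable_cong[THEN iffD1, rotated]) (auto simp: indicator_def)
    show "AE s in lborel. norm (indicator {0..} s * (d s + e s)\<^sup>2)
        \<le> norm (2 * (indicator {0..} s * (d s)\<^sup>2) + 2 * (indicator {0..} s * (e s)\<^sup>2))"
    proof (rule AE_I2)
      fix s :: real
      have "(d s + e s)\<^sup>2 \<le> 2 * (d s)\<^sup>2 + 2 * (e s)\<^sup>2"
        using sum_squares_bound[of "d s" "e s"] by (simp add: power2_sum)
      then show "norm (indicator {0..} s * (d s + e s)\<^sup>2)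
          \<le> norm (2 * (indicator {0..} s * (d s)\<^sup>2) + 2 * (indicator {0..} s * (e s)\<^sup>2))"
        by (auto simp: indicator_def)
    qed
  qed
  show ?thesis
    using 1 2 by (simp add: square_integrable_def set_borel_measurable_def set_integrable_def)
qed

lemma square_integrable_scale:
  assumes "square_integrable d"
  shows "square_integrable (\<lambda>s. c * d s)"
proof -
  have [measurable]: "(\<lambda>s. indicator {0..} s * d s) \<in> borel_measurable lborel"
    using assms by (simp add: square_integrable_def set_borel_measurable_def)
  have "(\<lambda>s. c * (indicator {0..} s * d s)) \<in> borel_measurable lborel"
    by measurable
  moreover have "integrable lborel (\<lambda>s. c\<^sup>2 * (indicator {0..} s * (d s)\<^sup>2))"
    using assms by (auto simp: square_integrable_def set_integrable_def)
  ultimately show ?thesis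
    by (simp add: square_integrable_def set_borel_measurable_def set_integrable_def
        power_mult_distrib mult.left_commute)
qed

lemma square_integrable_zero: "square_integrable (\<lambda>_. 0)"
  by (simp add: square_integrable_def set_borel_measurable_def set_integrable_def)

lemma square_integrable_local:
  assumes "square_integrable d"
  shows "set_integrable lborel {0..t} d"
proof -
  have m [measurable]: "(\<lambda>s. indicator {0..} s * d s) \<in> borel_measurable lborel"
    using assms by (auto simp: square_integrable_def set_borel_measurable_def)
  have "integrable lborel (\<lambda>s. indicator {0..t} s + indicator {0..} s * (d s)\<^sup>2)"
    using assms
    by (intro Bochner_Integration.integrable_add integrable_real_indicator)
      (auto simp: square_integrable_def set_integrable_def emeasure_lborel_Icc_eq)
  then have "integrable lborel (\<lambda>s. indicator {0..t} s * d s)"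
  proof (rule Bochner_Integration.integrable_bound)
    have "(\<lambda>s. indicator {0..t} s * (indicator {0..} s * d s)) \<in> borel_measurable lborel"
      by measurable
    then show "(\<lambda>s. indicator {0..t} s * d s) \<in> borel_measurable lborel"
      by (rule measurable_cong[THEN iffD1, rotated]) (auto simp: indicator_def)
    have "\<bar>x\<bar> \<le> 1 + x\<^sup>2" for x :: real
    proof -
      have "0 \<le> (\<bar>x\<bar> - 1)\<^sup>2 + \<bar>x\<bar>" by simp
      then show ?thesis by (simp add: power2_diff algebra_simps)
    qed
    then show "AE s in lborel. norm (indicator {0..t} s * d s)
        \<le> norm (indicator {0..t} s + indicator {0..} s * (d s)\<^sup>2)"
      by (intro AE_I2) (auto simp: indicator_def)
  qed
  then show ?thesis by (simp add: set_integrable_def)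
qed

lemma square_integrable_mult:
  assumes "square_integrable d" "square_integrable e"
  shows "set_integrable lborel {0..} (\<lambda>s. d s * e s)"
proof -
  have "set_integrable lborel {0..} (\<lambda>s. 1 / 2 * ((d s + e s)\<^sup>2 - (d s)\<^sup>2 - (e s)\<^sup>2))"
    using assms square_integrable_add[OF assms]
    by (intro set_integrable_mult_right set_integral_diff(1)) (auto simp: square_integrable_def)
  moreover have "(\<lambda>s. 1 / 2 * ((d s + e s)\<^sup>2 - (d s)\<^sup>2 - (e s)\<^sup>2)) = (\<lambda>s. d s * e s)"
    by (auto simp: power2_eq_square algebra_simps)
  ultimately show ?thesis by metis
qed

lemma indefinite_integral_zero_AE:
  fixes e :: "real \<Rightarrow> real"
  assumes int: "\<And>t. set_integrable lborel {0..t} e"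
    and zero: "\<And>t. t \<ge> 0 \<Longrightarrow> (LBINT s:{0..t}. e s) = 0"
  shows "AE s in lborel. s \<ge> 0 \<longrightarrow> e s = 0"
proof -
  have "AE s in lborel. indicator {0..real n} s * e s = 0" for n :: nat
  proof -
    define f where "f s = indicator {0..real n} s * e s" for s
    have f: "integrable lborel f"
      using int[of n] unfolding f_def set_integrable_def by simp
    have sf: "set_integrable lborel A f" if "A \<in> sets borel" for A
      using f that unfolding set_integrable_def by (intro integrable_mult_indicator) auto
    have gen: "(LBINT s:{..a}. f s) = 0" for a
    proof -
      have "(LBINT s:{..a}. f s) = (LBINT s:{0..min a n}. e s)"
        unfolding set_lebesgue_integral_def f_def
        by (intro Bochner_Integration.integral_cong) (auto simp: indicator_def)
      also have "\<dots> = 0"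
        using zero[of "min a n"] by (cases "min a n \<ge> 0") (auto simp: set_lebesgue_integral_def)
      finally show ?thesis .
    qed
    have all: "(LBINT s. f s) = 0"
    proof -
      have "(LBINT s. f s) = (LBINT s:{..real n}. f s)"
        unfolding set_lebesgue_integral_def f_def
        by (intro Bochner_Integration.integral_cong) (auto simp: indicator_def)
      with gen show ?thesis by simp
    qed
    have eq: "sets borel = sigma_sets UNIV (range (\<lambda>a::real. {..a}))"
      by (subst borel_eq_atMost) simp
    have "(LBINT s:A. f s) = 0" if "A \<in> sigma_sets UNIV (range (\<lambda>a::real. {..a}))" for A
    proof (rule sigma_sets_induct_disjoint[of "range (\<lambda>a::real. {..a})" UNIV A])
      show "Int_stable (range (\<lambda>a::real. {..a}))"
        by (auto simp: Int_stable_def)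
      show "A \<in> sigma_sets UNIV (range (\<lambda>a::real. {..a}))" by fact
      show "(LBINT s:B. f s) = 0" if "B \<in> range (\<lambda>a::real. {..a})" for B
        using that gen by auto
      show "(LBINT s:{}. f s) = 0" by (simp add: set_lebesgue_integral_def)
      show "(LBINT s:UNIV - B. f s) = 0"
        if B: "B \<in> sigma_sets UNIV (range (\<lambda>a::real. {..a}))" and z: "(LBINT s:B. f s) = 0" for B
      proof -
        have B': "B \<in> sets borel" using B eq by simp
        have "(LBINT s:(UNIV - B) \<union> B. f s) = (LBINT s:UNIV - B. f s) + (LBINT s:B. f s)"
          using B' by (intro set_integral_Un sf) auto
        moreover have "(UNIV - B) \<union> B = UNIV" by auto
        ultimately show ?thesis using z all by (simp add: set_lebesgue_integral_def)
      qed
      show "(LBINT s:\<Union> (range B). f s) = 0"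
        if "disjoint_family B" and B: "range B \<subseteq> sigma_sets UNIV (range (\<lambda>a::real. {..a}))"
          and z: "\<And>i::nat. (LBINT s:B i. f s) = 0" for B
      proof -
        have B': "B i \<in> sets borel" for i using B eq by auto
        have "(LBINT s:\<Union> (range B). f s) = (\<Sum>i. (LBINT s:B i. f s))"
          using B' that(1) by (intro lebesgue_integral_countable_add sf)
            (auto simp: disjoint_family_on_def)
        with z show ?thesis by simp
      qed
    qed auto
    then have "AE s in lborel. f s = 0"
      using f eq by (intro density_unique_real) (auto simp: set_lebesgue_integral_def)
    then show ?thesis by (simp add: f_def)
  qed
  then have "AE s in lborel. \<forall>n::nat. indicator {0..real n} s * e s = 0"
    unfolding AE_all_countable by blast
  then show ?thesis
  proof eventually_elim
    case (elim s)
    obtain n where "s \<le> real n" using real_arch_simple by blast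
    with spec[OF elim, of n] show ?case by (auto simp: indicator_def)
  qed
qed

lemma L2_derivative_add:
  assumes "L2_derivative h d" "L2_derivative g e"
  shows "L2_derivative (h + g) (\<lambda>s. d s + e s)"
  using assms
  by (auto simp: L2_derivative_def plus_path.rep_eq square_integrable_add square_integrable_local)

lemma L2_derivative_scale:
  assumes "L2_derivative h d"
  shows "L2_derivative (c *\<^sub>R h) (\<lambda>s. c * d s)"
  using assms
  by (auto simp: L2_derivative_def scaleR_path.rep_eq square_integrable_scale)

lemma L2_derivative_zero: "L2_derivative 0 (\<lambda>_. 0)"
  by (simp add: L2_derivative_def zero_path.rep_eq square_integrable_zero)

lemma L2_derivative_AE_unique:
  assumes "L2_derivative h d" "L2_derivative h e"
  shows "AE s in lborel. s \<ge> 0 \<longrightarrow> d s = e s"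
proof -
  have "AE s in lborel. s \<ge> 0 \<longrightarrow> d s - e s = 0"
    using assms
    by (intro indefinite_integral_zero_AE)
      (auto simp: L2_derivative_def square_integrable_local intro!: set_integral_diff(1))
  then show ?thesis by simp
qed

text \<open>The elements of the Cameron--Martin space are automatically continuous and vanish at \<open>0\<close>,
  so the space is carved out of the path space; it inherits only the vector space structure.\<close>

typedef cameron_martin = "{h :: path. \<exists>d. L2_derivative h d}"
  morphisms cm_path Abs_cm
  using L2_derivative_zero by blast

setup_lifting type_definition_cameron_martin

text \<open>The derivative is unique almost everywhere only; \<open>cm_deriv\<close> picks a version.\<close>

definition cm_deriv :: "cameron_martin \<Rightarrow> real \<Rightarrow> real" where
  "cm_deriv h = (SOME d. L2_derivative (cm_path h) d)"

lemma L2_derivative_cm_deriv: "L2_derivative (cm_path h) (cm_deriv h)"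
proof -
  have "\<exists>d. L2_derivative (cm_path h) d" using cm_path[of h] by simp
  then show ?thesis unfolding cm_deriv_def by (rule someI_ex)
qed

lemma cm_deriv_unique:
  "L2_derivative (cm_path h) d \<Longrightarrow> AE s in lborel. s \<ge> 0 \<longrightarrow> cm_deriv h s = d s"
  by (rule L2_derivative_AE_unique[OF L2_derivative_cm_deriv])

lemma square_integrable_cm_deriv: "square_integrable (cm_deriv h)"
  using L2_derivative_cm_deriv by (simp add: L2_derivative_def)

instantiation cameron_martin :: real_inner
begin

lift_definition zero_cameron_martin :: cameron_martin is 0
  using L2_derivative_zero by blast
lift_definition plus_cameron_martin :: "cameron_martin \<Rightarrow> cameron_martin \<Rightarrow> cameron_martin" is "(+)"
  using L2_derivative_add by blast
lift_definition scaleR_cameron_martin :: "real \<Rightarrow> cameron_martin \<Rightarrow> cameron_martin" is "(*\<^sub>R)"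
  using L2_derivative_scale by blast
definition "- h = (-1) *\<^sub>R (h :: cameron_martin)"
definition "h - g = h + - (g :: cameron_martin)"

definition inner_cameron_martin :: "cameron_martin \<Rightarrow> cameron_martin \<Rightarrow> real" where
  "inner_cameron_martin h g = (LBINT s:{0..}. cm_deriv h s * cm_deriv g s)"
definition norm_cameron_martin :: "cameron_martin \<Rightarrow> real" where
  "norm_cameron_martin h = sqrt (inner h h)"
definition sgn_cameron_martin :: "cameron_martin \<Rightarrow> cameron_martin" where
  "sgn_cameron_martin h = inverse (norm h) *\<^sub>R h"
definition dist_cameron_martin :: "cameron_martin \<Rightarrow> cameron_martin \<Rightarrow> real" where
  "dist_cameron_martin h g = norm (h - g)"
definition uniformity_cameron_martin :: "(cameron_martin \<times> cameron_martin) filter" where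
  "uniformity_cameron_martin = (INF e\<in>{0<..}. principal {(h, g). dist h g < e})"
definition open_cameron_martin :: "cameron_martin set \<Rightarrow> bool" where
  "open_cameron_martin U \<longleftrightarrow> (\<forall>h\<in>U. \<forall>\<^sub>F (h', g) in uniformity. h' = h \<longrightarrow> g \<in> U)"

instance
proof
  fix f g h :: cameron_martin and r s :: real and U :: "cameron_martin set"
  show "f + g + h = f + (g + h)" "f + g = g + f" "0 + f = f"
    "r *\<^sub>R (f + g) = r *\<^sub>R f + r *\<^sub>R g" "(r + s) *\<^sub>R f = r *\<^sub>R f + s *\<^sub>R f"
    "r *\<^sub>R s *\<^sub>R f = (r * s) *\<^sub>R f" "1 *\<^sub>R f = f"
    by (transfer; simp add: algebra_simps)+
  show "- f + f = 0"
    unfolding uminus_cameron_martin_def by transfer simp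
  show "f - g = f + - g" by (rule minus_cameron_martin_def)
  show "sgn f = inverse (norm f) *\<^sub>R f" by (rule sgn_cameron_martin_def)
  show "dist f g = norm (f - g)" by (rule dist_cameron_martin_def)
  show "uniformity = (INF e\<in>{0<..}. principal {(h, g :: cameron_martin). dist h g < e})"
    by (rule uniformity_cameron_martin_def)
  show "open U \<longleftrightarrow> (\<forall>h\<in>U. \<forall>\<^sub>F (h', g) in uniformity. h' = h \<longrightarrow> g \<in> U)"
    by (rule open_cameron_martin_def)
  show "norm f = sqrt (inner f f)" by (rule norm_cameron_martin_def)
  show "inner f g = inner g f"
    by (simp add: inner_cameron_martin_def mult.commute)
  show "0 \<le> inner f f"
    unfolding inner_cameron_martin_def set_lebesgue_integral_def
    by (intro Bochner_Integration.integral_nonneg) (auto simp: indicator_def)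
  have cong: "(LBINT s:{0..}. d s * cm_deriv h s) = (LBINT s:{0..}. e s * cm_deriv h s)"
    if ae: "AE s in lborel. s \<ge> 0 \<longrightarrow> d s = e s"
      and d: "square_integrable d" and e: "square_integrable e" for d e
  proof -
    have "set_integrable lborel {0..} (\<lambda>s. d s * cm_deriv h s)"
      "set_integrable lborel {0..} (\<lambda>s. e s * cm_deriv h s)"
      using d e square_integrable_cm_deriv by (intro square_integrable_mult; simp)+
    then have "(\<lambda>s. indicator {0..} s *\<^sub>R (d s * cm_deriv h s)) \<in> borel_measurable lborel"
      "(\<lambda>s. indicator {0..} s *\<^sub>R (e s * cm_deriv h s)) \<in> borel_measurable lborel"
      unfolding set_integrable_def by (blast intro: borel_measurable_integrable)+
    moreover have "AE s in lborel. indicator {0..} s *\<^sub>R (d s * cm_deriv h s)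
        = indicator {0..} s *\<^sub>R (e s * cm_deriv h s)"
      using ae by eventually_elim (auto simp: indicator_def)
    ultimately show ?thesis
      unfolding set_lebesgue_integral_def by (intro integral_cong_AE) auto
  qed
  show "inner (f + g) h = inner f h + inner g h"
  proof -
    have L: "L2_derivative (cm_path (f + g)) (\<lambda>s. cm_deriv f s + cm_deriv g s)"
      by (simp add: plus_cameron_martin.rep_eq L2_derivative_add L2_derivative_cm_deriv)
    have "inner (f + g) h = (LBINT s:{0..}. (cm_deriv f s + cm_deriv g s) * cm_deriv h s)"
      unfolding inner_cameron_martin_def
      by (intro cong cm_deriv_unique[OF L] square_integrable_cm_deriv square_integrable_add)
    also have "\<dots> = inner f h + inner g h"
      by (simp add: inner_cameron_martin_def distrib_right square_integrable_mult
          square_integrable_cm_deriv)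
    finally show ?thesis .
  qed
  show "inner (r *\<^sub>R f) h = r * inner f h"
  proof -
    have L: "L2_derivative (cm_path (r *\<^sub>R f)) (\<lambda>s. r * cm_deriv f s)"
      by (simp add: scaleR_cameron_martin.rep_eq L2_derivative_scale L2_derivative_cm_deriv)
    have "inner (r *\<^sub>R f) h = (LBINT s:{0..}. (r * cm_deriv f s) * cm_deriv h s)"
      unfolding inner_cameron_martin_def
      by (intro cong cm_deriv_unique[OF L] square_integrable_cm_deriv square_integrable_scale)
    also have "\<dots> = r * inner f h"
      by (simp add: inner_cameron_martin_def mult.assoc)
    finally show ?thesis .
  qed
  show "inner f f = 0 \<longleftrightarrow> f = 0"
  proof
    assume "f = 0"
    have "AE s in lborel. s \<ge> 0 \<longrightarrow> cm_deriv (0 :: cameron_martin) s = 0"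
      by (rule cm_deriv_unique) (simp add: zero_cameron_martin.rep_eq L2_derivative_zero)
    then have "AE s in lborel. indicator {0..} s *\<^sub>R (cm_deriv f s * cm_deriv f s) = 0"
      unfolding \<open>f = 0\<close> by eventually_elim (auto simp: indicator_def)
    then show "inner f f = 0"
      unfolding inner_cameron_martin_def set_lebesgue_integral_def
      by (rule integral_eq_zero_AE)
  next
    assume 0: "inner f f = 0"
    have "integrable lborel (\<lambda>s. indicator {0..} s *\<^sub>R (cm_deriv f s * cm_deriv f s))"
      using square_integrable_mult[OF square_integrable_cm_deriv square_integrable_cm_deriv]
      by (simp add: set_integrable_def)
    then have "AE s in lborel. indicator {0..} s *\<^sub>R (cm_deriv f s * cm_deriv f s) = 0"
      using 0 unfolding inner_cameron_martin_def set_lebesgue_integral_def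
      by (subst (asm) integral_nonneg_eq_0_iff_AE) (auto simp: indicator_def)
    then have ae: "AE s in lborel. s \<ge> 0 \<longrightarrow> cm_deriv f s = 0"
      by eventually_elim (auto simp: indicator_def)
    have "path_fun (cm_path f) t = 0" for t
    proof (cases "t \<ge> 0")
      case True
      then have "path_fun (cm_path f) t = (LBINT s:{0..t}. cm_deriv f s)"
        using L2_derivative_cm_deriv[of f] by (simp add: L2_derivative_def)
      also have "\<dots> = 0"
        unfolding set_lebesgue_integral_def
        by (rule integral_eq_zero_AE, use ae in eventually_elim) (auto simp: indicator_def)
      finally show ?thesis .
    next
      case False
      then show ?thesis using path_fun[of "cm_path f"] by auto
    qed
    then have "path_fun (cm_path f) = path_fun 0"
      by (auto simp: zero_path.rep_eq)
    then show "f = 0"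
      by (simp add: path_fun_inject cm_path_inject[symmetric] zero_cameron_martin.rep_eq)
  qed
qed

end

section \<open>The random time\<close>

definition mittag_leffler :: "real \<Rightarrow> real \<Rightarrow> real" where
  "mittag_leffler \<beta> z = (\<Sum>n. z ^ n / Gamma (\<beta> * real n + 1))"

text \<open>The Laplace transform at \<open>s = 0\<close> makes \<open>M\<close> a probability density, and by uniqueness of
  Laplace transforms \<open>M\<close> is determined up to null sets.\<close>

definition M_density :: "real \<Rightarrow> (real \<Rightarrow> real) \<Rightarrow> bool" where
  "M_density \<beta> M \<longleftrightarrow>
     M \<in> borel_measurable (restrict_space lborel {0..}) \<and> (\<forall>\<tau>\<ge>0. 0 \<le> M \<tau>) \<and>
     (\<forall>s\<ge>0. (LBINT \<tau>:{0..}. exp (- s * \<tau>) * M \<tau>) = mittag_leffler \<beta> (- s))"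

definition time_law :: "(real \<Rightarrow> real) \<Rightarrow> real measure" where
  "time_law M = density (restrict_space lborel {0..}) (\<lambda>\<tau>. ennreal (M \<tau>))"

definition X_proc :: "real \<Rightarrow> path \<times> real \<Rightarrow> real" where
  "X_proc t = (\<lambda>(w, \<tau>). path_fun w (t * \<tau>))"

definition X_algebra :: "real \<Rightarrow> (path \<times> real) measure" where
  "X_algebra T = sigma (UNIV \<times> {0..})
     {X_proc t -` B \<inter> (UNIV \<times> {0..}) | t B. t \<in> {0..T} \<and> B \<in> sets borel}"

section \<open>Smooth cylinder functions and the gradient\<close>

definition partial_deriv :: "nat \<Rightarrow> ((nat \<Rightarrow> real) \<Rightarrow> real) \<Rightarrow> (nat \<Rightarrow> real) \<Rightarrow> real" where
  "partial_deriv i f x = deriv (\<lambda>s. f (x(i := s))) (x i)"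

text \<open>\<open>C\<^sub>b\<^sup>\<infinity>(\<real>\<^sup>n)\<close>, with \<open>\<real>\<^sup>n\<close> realised as \<^const>\<open>Euclidean_space\<close>: all iterated partial derivatives
  exist, are continuous and bounded. The list \<open>is\<close> is the sequence of differentiation indices.\<close>

definition smooth_bounded :: "nat \<Rightarrow> ((nat \<Rightarrow> real) \<Rightarrow> real) \<Rightarrow> bool" where
  "smooth_bounded n f \<longleftrightarrow>
     (\<forall>is. set is \<subseteq> {..<n} \<longrightarrow>
        (let g = foldr partial_deriv is f in
          continuous_map (Euclidean_space n) euclideanreal g \<and>
          (\<exists>B. \<forall>x\<in>topspace (Euclidean_space n). \<bar>g x\<bar> \<le> B) \<and>
          (\<forall>x\<in>topspace (Euclidean_space n). \<forall>i<n.
             (\<lambda>s. g (x(i := s))) field_differentiable at (x i))))"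

definition cylinder_functions :: "real \<Rightarrow> (path \<times> real \<Rightarrow> real) set" where
  "cylinder_functions T =
     {F. \<exists>n t f. 0 < n \<and> strict_mono_on {..<n} t \<and> t ` {..<n} \<subseteq> {0<..T} \<and> smooth_bounded n f \<and>
           F = (\<lambda>(w, \<tau>). f (\<lambda>i. if i < n then path_fun w (t i * \<tau>) else 0))}"

definition dir_deriv :: "cameron_martin \<Rightarrow> (path \<times> real \<Rightarrow> real) \<Rightarrow> path \<times> real \<Rightarrow> real" where
  "dir_deriv h F = (\<lambda>(w, \<tau>). Lim (at 0) (\<lambda>\<epsilon>. (F (w + \<epsilon> *\<^sub>R cm_path h, \<tau>) - F (w, \<tau>)) / \<epsilon>))"

definition gradient :: "(path \<times> real \<Rightarrow> real) \<Rightarrow> path \<times> real \<Rightarrow> cameron_martin" where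
  "gradient F x = (THE g. \<forall>h. dir_deriv h F x = inner g h)"

section \<open>\<open>L\<^sup>p\<close> spaces\<close>

text \<open>\<open>L\<^sup>p\<close> of \<open>N\<close> restricted to a sub-\<open>\<sigma>\<close>-algebra \<open>A\<close>. As classes modulo \<open>N\<close>-null sets are meant, a function
  belongs to it when it has an \<open>A\<close>-measurable version; the integrals are taken with respect to the
  full measure \<open>N\<close>, which leaves the norm unchanged. For the separable space
  \<^typ>\<open>cameron_martin\<close>, Borel measurability is strong measurability.\<close>

definition Lp_space ::
    "real \<Rightarrow> 'a measure \<Rightarrow> 'a measure \<Rightarrow> ('a \<Rightarrow> 'b :: real_normed_vector) set" where
  "Lp_space p N A =
     {Z. \<exists>Z'\<in>borel_measurable A. (AE x in N. Z x = Z' x) \<and>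
           (\<integral>\<^sup>+x. ennreal (norm (Z' x) powr p) \<partial>N) < \<infinity>}"

definition Lp_converges ::
    "real \<Rightarrow> 'a measure \<Rightarrow> (nat \<Rightarrow> 'a \<Rightarrow> 'b :: real_normed_vector) \<Rightarrow> ('a \<Rightarrow> 'b) \<Rightarrow> bool" where
  "Lp_converges p N F G \<longleftrightarrow>
     (\<lambda>n. \<integral>\<^sup>+x. ennreal (norm (F n x - G x) powr p) \<partial>N) \<longlonglongrightarrow> 0"

end

theory Submission
  imports Defs
begin

text \<open>The gradient differentiates in the path \<open>w\<close> only, so the random time \<open>\<tau>\<close> is a bystander and
  closability is a statement about shifts of Wiener measure.

  Let \<open>k\<^sub>b(t) = t \<and> b\<close>. This element of the Cameron--Martin space represents evaluation at \<open>b\<close>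
  (\<open>inner_cm_kernel\<close>), so \<open>Z\<close> is zero as soon as \<open>z = (k\<^sub>b, Z)\<close> vanishes almost surely for each
  positive rational \<open>b\<close>: it suffices to treat one direction \<open>k\<^sub>b\<close> at a time. For a cylinder function
  \<open>F\<close> the map \<open>s \<mapsto> F(w + s k\<^sub>b, \<tau>)\<close> is continuously differentiable with derivative
  \<open>(k\<^sub>b, \<nabla>F(w + s k\<^sub>b, \<tau>))\<close>, and therefore
  \<open>F(w + u k\<^sub>b, \<tau>) - F(w, \<tau>) = \<integral>\<^sub>0\<^sup>u (k\<^sub>b, \<nabla>F(w + s k\<^sub>b, \<tau>)) ds\<close>.

  This identity can be passed to the limit. By the Cameron--Martin theorem (\<open>cameron_martin\<close>) the
  shift by \<open>s k\<^sub>b\<close> changes Wiener measure by the density \<open>exp (s w(b) - s\<^sup>2 b / 2)\<close>, which yields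
  an \<open>L\<^sup>1\<close> bound for shifted functions on every event \<open>\<bar>w(b)\<bar> \<le> K\<close>, uniformly for \<open>s\<close> in a bounded
  interval (\<open>nn_integral_shift_le\<close>). If \<open>F\<^sub>n \<rightarrow> 0\<close> and \<open>\<nabla>F\<^sub>n \<rightarrow> Z\<close>, the left-hand side for \<open>F\<^sub>n\<close>
  tends to \<open>0\<close> in \<open>L\<^sup>1\<close> on such events and the right-hand side to \<open>\<integral>\<^sub>0\<^sup>u z(w + s k\<^sub>b, \<tau>) ds\<close>. This
  integral is thus zero for all \<open>u\<close>, so \<open>z\<close> vanishes at almost every point of almost every line in the
  direction \<open>k\<^sub>b\<close>. Fubini's theorem and the equivalence of Wiener measure with its shifts give \<open>z = 0\<close>
  almost surely (\<open>closable_direction\<close>). Convergence in \<open>L\<^sup>1\<close> is all that enters, and on a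
  probability space it follows from convergence in \<open>L\<^sup>p\<close> or \<open>L\<^sup>q\<close>.

  The Cameron--Martin theorem for the directions \<open>k\<^sub>b\<close> is elementary. On a time grid through \<open>b\<close> the
  Brownian increments are independent and normal, and \<open>k\<^sub>b\<close> adds to each increment before \<open>b\<close> its
  variance and leaves the later ones alone; so the claim reduces to the tilting of one-dimensional
  normal densities. Finite-dimensional distributions then determine the measure on the
  \<open>\<sigma>\<close>-algebra generated by the evaluations.\<close>

section \<open>The reproducing kernel of the Cameron--Martin space\<close>

text \<open>The outer maximum makes the path vanish on the negative half-line, as the encoding of paths
  demands; for \<open>b, t \<ge> 0\<close> the value is \<open>t \<and> b\<close>, the covariance of Brownian motion.\<close>

lift_definition min_path :: "real \<Rightarrow> path" is "\<lambda>b t. max 0 (min t b)"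
  by (auto intro!: continuous_intros)

lemma path_fun_nonpos: "t \<le> 0 \<Longrightarrow> path_fun w t = 0"
  using path_fun[of w] by (cases "t = 0") auto

lemma continuous_on_path: "continuous_on {0..} (path_fun w)"
  using path_fun[of w] by auto

lemma L2_derivative_min_path: "L2_derivative (min_path b) (indicator {0..b})"
proof -
  have "integrable lborel (\<lambda>s. indicator {0..b} s :: real)"
    by (intro integrable_real_indicator) (auto simp: emeasure_lborel_Icc_eq)
  moreover have "(\<lambda>s. indicator {0..} s * (indicator {0..b} s)\<^sup>2) = (\<lambda>s. indicator {0..b} s :: real)"
    by (auto simp: indicator_def)
  ultimately have "square_integrable (indicator {0..b})"
    by (simp add: square_integrable_def set_borel_measurable_def set_integrable_def)
  moreover have "max 0 (min t b) = (LBINT s:{0..t}. indicator {0..b} s)" for t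
  proof -
    have "(\<lambda>s. indicator {0..t} s * indicator {0..b} s) = (\<lambda>s. indicator {0..min t b} s :: real)"
      by (auto simp: indicator_def)
    then have "(LBINT s:{0..t}. indicator {0..b} s) = (LBINT s. indicator {0..min t b} s :: real)"
      by (simp add: set_lebesgue_integral_def)
    also have "\<dots> = max 0 (min t b)"
      by (auto simp: measure_def emeasure_lborel_Icc_eq)
    finally show ?thesis by simp
  qed
  ultimately show ?thesis
    by (simp add: L2_derivative_def min_path.rep_eq)
qed

lift_definition cm_kernel :: "real \<Rightarrow> cameron_martin" is min_path
  using L2_derivative_min_path by blast

text \<open>The derivative of the kernel is the indicator of \<open>[0,b]\<close>, so pairing with it integrates
  \<open>g\<close>'s derivative up to \<open>b\<close>, which recovers \<open>g(b)\<close>.\<close>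

lemma inner_cm_kernel: "inner (cm_kernel b) g = path_fun (cm_path g) b"
proof -
  have "AE s in lborel. s \<ge> 0 \<longrightarrow> cm_deriv (cm_kernel b) s = indicator {0..b} s"
    by (intro cm_deriv_unique) (simp add: cm_kernel.rep_eq L2_derivative_min_path)
  moreover have "(\<lambda>s. indicator {0..} s *\<^sub>R (cm_deriv (cm_kernel b) s * cm_deriv g s))
      \<in> borel_measurable lborel"
    using square_integrable_mult[OF square_integrable_cm_deriv square_integrable_cm_deriv]
    unfolding set_integrable_def by (blast intro: borel_measurable_integrable)
  moreover have "(\<lambda>s. indicator {0..b} s *\<^sub>R cm_deriv g s) \<in> borel_measurable lborel"
    using square_integrable_local[OF square_integrable_cm_deriv]
    unfolding set_integrable_def by (blast intro: borel_measurable_integrable)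
  ultimately have "inner (cm_kernel b) g = (LBINT s:{0..b}. cm_deriv g s)"
    unfolding inner_cameron_martin_def set_lebesgue_integral_def
    by (intro integral_cong_AE) (auto elim!: eventually_mono simp: indicator_def)
  also have "\<dots> = path_fun (cm_path g) b"
    using L2_derivative_cm_deriv[of g]
    by (cases "b \<ge> 0") (auto simp: L2_derivative_def path_fun_nonpos set_lebesgue_integral_def)
  finally show ?thesis .
qed

lemma continuous_zero_on_rationals:
  fixes f :: "real \<Rightarrow> real"
  assumes f: "continuous_on {0..} f" and 0: "\<And>r. r \<in> \<rat> \<Longrightarrow> 0 < r \<Longrightarrow> f r = 0" and t: "0 \<le> t"
  shows "f t = 0"
proof (rule continuous_constant_on_closure[of "{0<..} \<inter> \<rat>" f 0 t])
  have "closure ({0<..} \<inter> \<rat>) = closure {0::real<..}"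
    by (rule closure_open_Int_superset) (auto simp: Rats_closure_real)
  then have cl: "closure ({0::real<..} \<inter> \<rat>) = {0..}"
    by simp
  show "continuous_on (closure ({0<..} \<inter> \<rat>)) f"
    unfolding cl by fact
  show "t \<in> closure ({0<..} \<inter> \<rat>)"
    unfolding cl using t by simp
qed (auto intro: 0)

text \<open>Countably many directions suffice to detect a nonzero element, which allows exceptional null
  sets to depend on the direction.\<close>

lemma cameron_martin_eq_0I:
  assumes "\<And>b. b \<in> \<rat> \<Longrightarrow> 0 < b \<Longrightarrow> inner (cm_kernel b) g = 0"
  shows "g = 0"
proof -
  have "path_fun (cm_path g) t = path_fun 0 t" for t
    using continuous_zero_on_rationals[OF continuous_on_path, of "cm_path g" t] assms
    by (cases "t \<ge> 0") (auto simp: inner_cm_kernel zero_path.rep_eq path_fun_nonpos)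
  then show ?thesis
    by (auto simp: path_fun_inject[symmetric] cm_path_inject[symmetric] zero_cameron_martin.rep_eq)
qed

section \<open>Cylinder functions along lines\<close>

lemma
  assumes "smooth_bounded n f"
  shows smooth_bounded_continuous: "continuous_on {x. \<forall>i\<ge>n. x i = 0} f"
    and smooth_bounded_continuous_partial:
      "i < n \<Longrightarrow> continuous_on {x. \<forall>i\<ge>n. x i = 0} (partial_deriv i f)"
    and smooth_bounded_has_partial:
      "\<forall>j\<ge>n. x j = 0 \<Longrightarrow> i < n \<Longrightarrow>
        ((\<lambda>s. f (x(i := s))) has_real_derivative partial_deriv i f (x(i := v))) (at v)"
proof -
  have E: "Euclidean_space n = top_of_set {x. \<forall>i\<ge>n. x i = 0}"
    by (simp add: Euclidean_space_def euclidean_product_topology)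
  show "continuous_on {x. \<forall>i\<ge>n. x i = 0} f"
    using assms unfolding smooth_bounded_def by (auto simp: E Let_def dest: spec[of _ "[]"])
  show "i < n \<Longrightarrow> continuous_on {x. \<forall>i\<ge>n. x i = 0} (partial_deriv i f)"
    using assms unfolding smooth_bounded_def by (auto simp: E Let_def dest: spec[of _ "[i]"])
  assume x: "\<forall>j\<ge>n. x j = 0" and i: "i < n"
  have D: "\<forall>y\<in>topspace (Euclidean_space n). \<forall>i<n. (\<lambda>s. f (y(i := s))) field_differentiable at (y i)"
    using assms unfolding smooth_bounded_def by (auto simp: Let_def dest: spec[of _ "[]"])
  have "x(i := v) \<in> topspace (Euclidean_space n)"
    using x i by (auto simp: topspace_Euclidean_space)
  with D i have "(\<lambda>s. f ((x(i := v))(i := s))) field_differentiable at ((x(i := v)) i)" by blast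
  then show "((\<lambda>s. f (x(i := s))) has_real_derivative partial_deriv i f (x(i := v))) (at v)"
    by (simp add: partial_deriv_def DERIV_deriv_iff_field_differentiable)
qed

lemma tendsto_fun_iff:
  fixes f :: "'a \<Rightarrow> 'b \<Rightarrow> 'c::topological_space"
  shows "(f \<longlongrightarrow> l) F \<longleftrightarrow> (\<forall>i. ((\<lambda>x. f x i) \<longlongrightarrow> l i) F)"
  using limitin_componentwise[of "\<lambda>_. euclidean" "UNIV :: 'b set" f l F]
  by (simp add: euclidean_product_topology)

text \<open>This form holds for either sign of the increment \<open>d\<close> and also for \<open>d = 0\<close>.\<close>

lemma mean_value_unit:
  fixes \<phi> :: "real \<Rightarrow> real"
  assumes "\<And>v. (\<phi> has_real_derivative \<phi>' v) (at v)"
  shows "\<exists>\<theta>. 0 \<le> \<theta> \<and> \<theta> \<le> 1 \<and> \<phi> (a + d) - \<phi> a = d * \<phi>' (a + \<theta> * d)"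
proof -
  have "((\<lambda>v. \<phi> (a + v * d)) has_real_derivative \<phi>' (a + v * d) * d) (at v)" for v
    by (rule DERIV_chain2[OF assms]) (auto intro!: derivative_eq_intros)
  then obtain \<theta> where "0 < \<theta>" "\<theta> < 1" "\<phi> (a + 1 * d) - \<phi> (a + 0 * d) = (1 - 0) * (\<phi>' (a + \<theta> * d) * d)"
    using MVT2[of 0 1 "\<lambda>v. \<phi> (a + v * d)" "\<lambda>v. \<phi>' (a + v * d) * d"] by auto
  then show ?thesis by (intro exI[of _ \<theta>]) (auto simp: mult.commute)
qed

text \<open>Only partial derivatives are given, so the chain rule along a line is obtained by switching on
  the coordinates of the displacement one at a time. Each switch is a one-dimensional increment, given
  by the mean value theorem, and continuity of the partial derivative identifies its limit.\<close>

lemma smooth_bounded_directional_0: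
  assumes f: "smooth_bounded n f" and x: "\<forall>j\<ge>n. x j = 0" and y: "\<forall>j\<ge>n. y j = 0"
  shows "((\<lambda>s. f (\<lambda>j. x j + s * y j)) has_real_derivative (\<Sum>i<n. partial_deriv i f x * y i)) (at 0)"
proof -
  \<comment> \<open>the displaced point, with only the first \<open>k\<close> coordinates moved\<close>
  define X where "X s k = (\<lambda>j. x j + (if j < k then s * y j else 0))" for s k
  have fin: "X s n = (\<lambda>j. x j + s * y j)" for s
    using y by (auto simp: X_def fun_eq_iff)
  have "((\<lambda>s. f (X s k)) has_real_derivative (\<Sum>i<k. partial_deriv i f x * y i)) (at 0)" if "k \<le> n" for k
    using that
  proof (induction k)
    case 0
    then show ?case by (simp add: X_def)
  next
    case (Suc k)
    define g where "g s = f (X s (Suc k)) - f (X s k)" for s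
    have upd: "X s (Suc k) = (X s k)(k := x k + s * y k)" for s
      by (auto simp: X_def fun_eq_iff less_Suc_eq)
    have X0: "\<forall>j\<ge>n. X s k j = 0" for s
      using x y by (auto simp: X_def)
    have Xk: "(X s k)(k := x k) = X s k" for s
      by (simp add: X_def fun_eq_iff)
    have "\<exists>\<theta>. 0 \<le> \<theta> \<and> \<theta> \<le> 1 \<and>
        f ((X s k)(k := x k + s * y k)) - f ((X s k)(k := x k)) =
        (s * y k) * partial_deriv k f ((X s k)(k := x k + \<theta> * (s * y k)))" for s
      using smooth_bounded_has_partial[OF f X0] Suc.prems
      by (intro mean_value_unit[of "\<lambda>v. f ((X s k)(k := v))" "\<lambda>v. partial_deriv k f ((X s k)(k := v))"]) auto
    then have "\<forall>s. \<exists>\<theta>. 0 \<le> \<theta> \<and> \<theta> \<le> 1 \<and>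
        g s = (s * y k) * partial_deriv k f ((X s k)(k := x k + \<theta> * (s * y k)))"
      unfolding g_def upd Xk by (rule allI)
    then obtain \<theta> where "\<forall>s. 0 \<le> \<theta> s \<and> \<theta> s \<le> 1 \<and>
        g s = (s * y k) * partial_deriv k f ((X s k)(k := x k + \<theta> s * (s * y k)))"
      by (rule choice[THEN exE])
    then have \<theta>: "0 \<le> \<theta> s" "\<theta> s \<le> 1"
      and g: "g s = (s * y k) * partial_deriv k f ((X s k)(k := x k + \<theta> s * (s * y k)))" for s
      by blast+
    have "((\<lambda>s. (X s k)(k := x k + \<theta> s * (s * y k))) \<longlongrightarrow> x) (at 0)"
      unfolding tendsto_fun_iff
    proof
      fix j
      have "((\<lambda>s. x k + \<theta> s * (s * y k)) \<longlongrightarrow> x k + 0) (at 0)"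
      proof (intro tendsto_add tendsto_const)
        have "((\<lambda>s. \<bar>s * y k\<bar>) \<longlongrightarrow> \<bar>0 * y k\<bar>) (at 0)"
          by (intro tendsto_intros)
        then have "((\<lambda>s. \<bar>s * y k\<bar>) \<longlongrightarrow> 0) (at 0)" by simp
        then show "((\<lambda>s. \<theta> s * (s * y k)) \<longlongrightarrow> 0) (at 0)"
          by (rule Lim_null_comparison[rotated])
            (auto simp: abs_mult \<theta> intro!: mult_left_le_one_le always_eventually)
      qed
      moreover have "((\<lambda>s. X s k j) \<longlongrightarrow> x j) (at 0)"
        unfolding X_def by (cases "j < k") (auto intro!: tendsto_eq_intros)
      ultimately show "((\<lambda>s. ((X s k)(k := x k + \<theta> s * (s * y k))) j) \<longlongrightarrow> x j) (at 0)"
        by (cases "j = k") auto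
    qed
    then have "((\<lambda>s. partial_deriv k f ((X s k)(k := x k + \<theta> s * (s * y k)))) \<longlongrightarrow> partial_deriv k f x) (at 0)"
      using x X0 Suc.prems
      by (intro continuous_on_tendsto_compose[OF smooth_bounded_continuous_partial[OF f]])
        (auto intro!: always_eventually)
    then have "((\<lambda>s. partial_deriv k f ((X s k)(k := x k + \<theta> s * (s * y k))) * y k)
        \<longlongrightarrow> partial_deriv k f x * y k) (at 0)"
      by (intro tendsto_intros)
    then have "((\<lambda>s. (g s - g 0) / (s - 0)) \<longlongrightarrow> partial_deriv k f x * y k) (at 0)"
      by (rule Lim_transform_eventually) (auto simp: g eventually_at_filter)
    then have "(g has_real_derivative partial_deriv k f x * y k) (at 0)"
      by (simp add: has_field_derivative_iff)
    moreover have "((\<lambda>s. f (X s k)) has_real_derivative (\<Sum>i<k. partial_deriv i f x * y i)) (at 0)"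
      using Suc by simp
    ultimately have "((\<lambda>s. f (X s k) + g s) has_real_derivative
        (\<Sum>i<k. partial_deriv i f x * y i) + partial_deriv k f x * y k) (at 0)"
      by (rule DERIV_add[rotated])
    then show ?case by (simp add: g_def)
  qed
  from this[of n] show ?thesis
    unfolding fin by simp
qed

lemma smooth_bounded_directional:
  assumes f: "smooth_bounded n f" and x: "\<forall>j\<ge>n. x j = 0" and y: "\<forall>j\<ge>n. y j = 0"
  shows "((\<lambda>s. f (\<lambda>j. x j + s * y j)) has_real_derivative
    (\<Sum>i<n. partial_deriv i f (\<lambda>j. x j + u * y j) * y i)) (at u)"
proof -
  have "((\<lambda>s. f (\<lambda>j. (x j + u * y j) + s * y j)) has_real_derivative
    (\<Sum>i<n. partial_deriv i f (\<lambda>j. x j + u * y j) * y i)) (at 0)"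
    using x y by (intro smooth_bounded_directional_0[OF f]) auto
  then have "((\<lambda>s. f (\<lambda>j. x j + (s + u) * y j)) has_real_derivative
    (\<Sum>i<n. partial_deriv i f (\<lambda>j. x j + u * y j) * y i)) (at 0)"
    by (simp add: algebra_simps)
  then show ?thesis
    using DERIV_shift[of "\<lambda>s. f (\<lambda>j. x j + s * y j)" _ 0 u] by simp
qed

definition sample :: "nat \<Rightarrow> (nat \<Rightarrow> real) \<Rightarrow> real \<Rightarrow> path \<Rightarrow> nat \<Rightarrow> real" where
  "sample n t \<tau> w = (\<lambda>i. if i < n then path_fun w (t i * \<tau>) else 0)"

lemma sample_add_scaleR:
  "sample n t \<tau> (w + s *\<^sub>R h) = (\<lambda>j. sample n t \<tau> w j + s * sample n t \<tau> h j)"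
  by (auto simp: sample_def plus_path.rep_eq scaleR_path.rep_eq)

lemma cylinder_functionsE:
  assumes "F \<in> cylinder_functions T"
  obtains n t f where "smooth_bounded n f" "\<And>w \<tau>. F (w, \<tau>) = f (sample n t \<tau> w)"
  using assms unfolding cylinder_functions_def sample_def by auto

context
  fixes F :: "path \<times> real \<Rightarrow> real" and n :: nat and t :: "nat \<Rightarrow> real" and f :: "(nat \<Rightarrow> real) \<Rightarrow> real"
  assumes f: "smooth_bounded n f" and F: "\<And>w \<tau>. F (w, \<tau>) = f (sample n t \<tau> w)"
begin

lemma sample_curve_derivative:
  "((\<lambda>s. F (w + s *\<^sub>R h, \<tau>)) has_real_derivative
     (\<Sum>i<n. partial_deriv i f (sample n t \<tau> (w + u *\<^sub>R h)) * sample n t \<tau> h i)) (at u)"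
  unfolding F sample_add_scaleR
  by (rule smooth_bounded_directional[OF f]) (auto simp: sample_def)

lemma dir_deriv_sample:
  "dir_deriv h F (w, \<tau>) =
     (\<Sum>i<n. partial_deriv i f (sample n t \<tau> w) * path_fun (cm_path h) (t i * \<tau>))"
proof -
  have "((\<lambda>s. (F (w + s *\<^sub>R cm_path h, \<tau>) - F (w, \<tau>)) / s) \<longlongrightarrow>
     (\<Sum>i<n. partial_deriv i f (sample n t \<tau> w) * sample n t \<tau> (cm_path h) i)) (at 0)"
    using sample_curve_derivative[of w "cm_path h" \<tau> 0] by (simp add: has_field_derivative_iff)
  then show ?thesis
    by (simp add: dir_deriv_def tendsto_Lim sample_def)
qed

text \<open>The gradient is defined by a unique-existence description; the combination of kernels
  satisfies it because the kernel at \<open>t\<^sub>i \<tau>\<close> represents evaluation at \<open>t\<^sub>i \<tau>\<close>.\<close>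

lemma inner_gradient_sample: "inner (gradient F (w, \<tau>)) h = dir_deriv h F (w, \<tau>)"
proof -
  define g where "g = (\<Sum>i<n. partial_deriv i f (sample n t \<tau> w) *\<^sub>R cm_kernel (t i * \<tau>))"
  have g: "inner g h = dir_deriv h F (w, \<tau>)" for h
    by (simp add: g_def inner_sum_left inner_cm_kernel dir_deriv_sample)
  have "gradient F (w, \<tau>) = g"
    unfolding gradient_def
  proof (rule the_equality)
    fix g' assume "\<forall>h. dir_deriv h F (w, \<tau>) = inner g' h"
    then show "g' = g" by (metis g vector_eq_rdot inner_commute)
  qed (simp add: g)
  then show ?thesis using g by simp
qed

end

lemma inner_gradient:
  assumes "F \<in> cylinder_functions T"
  shows "inner (gradient F x) h = dir_deriv h F x"
  using assms by (cases x) (auto elim!: cylinder_functionsE intro: inner_gradient_sample)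

lemma cylinder_has_derivative:
  assumes "F \<in> cylinder_functions T"
  shows "((\<lambda>s. F (w + s *\<^sub>R cm_path h, \<tau>)) has_real_derivative dir_deriv h F (w + u *\<^sub>R cm_path h, \<tau>)) (at u)"
  using assms
proof (rule cylinder_functionsE)
  fix n t f assume *: "smooth_bounded n f" "\<And>w \<tau>. F (w, \<tau>) = f (sample n t \<tau> w)"
  show ?thesis
    using sample_curve_derivative[OF *, of w "cm_path h" \<tau> u]
    by (simp add: dir_deriv_sample[OF *]) (simp add: sample_def)
qed

lemma continuous_dir_deriv:
  assumes "F \<in> cylinder_functions T"
  shows "continuous_on UNIV (\<lambda>s. dir_deriv h F (w + s *\<^sub>R cm_path h, \<tau>))"
  using assms
proof (rule cylinder_functionsE)
  fix n t f assume *: "smooth_bounded n f" "\<And>w \<tau>. F (w, \<tau>) = f (sample n t \<tau> w)"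
  show ?thesis
    unfolding dir_deriv_sample[OF *] sample_add_scaleR
  proof (intro continuous_intros)
    fix i assume i: "i \<in> {..<n}"
    show "continuous_on UNIV (\<lambda>s. partial_deriv i f (\<lambda>j. sample n t \<tau> w j + s * sample n t \<tau> (cm_path h) j))"
      using i
      by (intro continuous_on_compose2[OF smooth_bounded_continuous_partial[OF *(1)]]
          continuous_on_coordinatewise_then_product continuous_intros) (auto simp: sample_def)
  qed
qed

section \<open>The evaluation \<open>\<sigma>\<close>-algebra on the path space\<close>

text \<open>Cylinder functions and the functions measurable for the observed process depend on the path
  through evaluations only. On the \<open>\<sigma>\<close>-algebra generated by the evaluations a measure is determined
  by its finite-dimensional distributions, directly and without a description of the Borel sets of
  locally uniform convergence.\<close>

definition path_algebra :: "path measure" where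
  "path_algebra = vimage_algebra UNIV path_fun (Pi\<^sub>M UNIV (\<lambda>_. borel))"

lemma space_path_algebra [simp]: "space path_algebra = UNIV"
  by (simp add: path_algebra_def)

lemma measurable_path_fun_PiM: "path_fun \<in> path_algebra \<rightarrow>\<^sub>M Pi\<^sub>M UNIV (\<lambda>_. borel)"
  unfolding path_algebra_def by (rule measurable_vimage_algebra1) (auto simp: space_PiM)

lemma measurable_path_fun_fixed [measurable]: "(\<lambda>w. path_fun w t) \<in> borel_measurable path_algebra"
  by (rule measurable_compose[OF measurable_path_fun_PiM measurable_component_singleton]) simp

lemma measurable_path_algebraI:
  assumes "\<And>t. (\<lambda>x. path_fun (g x) t) \<in> borel_measurable N"
  shows "g \<in> N \<rightarrow>\<^sub>M path_algebra"
  unfolding path_algebra_def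
  by (rule measurable_vimage_algebra2) (auto intro!: measurable_PiM_single' assms)

lemma floor_grid_tendsto: "(\<lambda>k. real_of_int \<lfloor>real (Suc k) * t\<rfloor> / real (Suc k)) \<longlonglongrightarrow> t"
proof (rule tendsto_sandwich)
  show "\<forall>\<^sub>F k in sequentially. t - 1 / real (Suc k) \<le> real_of_int \<lfloor>real (Suc k) * t\<rfloor> / real (Suc k)"
  proof (rule always_eventually, rule allI)
    fix k
    have "(real (Suc k) * t - 1) / real (Suc k) \<le> real_of_int \<lfloor>real (Suc k) * t\<rfloor> / real (Suc k)"
      by (rule divide_right_mono) linarith+
    then show "t - 1 / real (Suc k) \<le> real_of_int \<lfloor>real (Suc k) * t\<rfloor> / real (Suc k)"
      by (simp add: diff_divide_distrib del: of_nat_Suc)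
  qed
  show "\<forall>\<^sub>F k in sequentially. real_of_int \<lfloor>real (Suc k) * t\<rfloor> / real (Suc k) \<le> t"
  proof (rule always_eventually, rule allI)
    fix k
    have "real_of_int \<lfloor>real (Suc k) * t\<rfloor> / real (Suc k) \<le> (real (Suc k) * t) / real (Suc k)"
      by (rule divide_right_mono) linarith+
    then show "real_of_int \<lfloor>real (Suc k) * t\<rfloor> / real (Suc k) \<le> t"
      by (simp del: of_nat_Suc)
  qed
  show "(\<lambda>k. t - 1 / real (Suc k)) \<longlonglongrightarrow> t"
    using tendsto_diff[OF tendsto_const lim_1_over_n[THEN LIMSEQ_Suc], of t] by simp
qed simp

text \<open>By continuity of paths, \<open>w(t)\<close> is the limit of the values of \<open>w\<close> at the grid points below \<open>t\<close>,
  and each of these approximations involves only countably many fixed times.\<close>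

lemma measurable_path_eval:
  "(\<lambda>(w, t). path_fun w t) \<in> borel_measurable (path_algebra \<Otimes>\<^sub>M borel)"
proof (rule borel_measurable_LIMSEQ_real)
  fix k :: nat
  show "(\<lambda>(w, t). path_fun w (real_of_int \<lfloor>real (Suc k) * t\<rfloor> / real (Suc k)))
      \<in> borel_measurable (path_algebra \<Otimes>\<^sub>M borel)"
    unfolding split_beta'
    by (rule measurable_compose_countable[where g = "\<lambda>x. \<lfloor>real (Suc k) * snd x\<rfloor>"
          and f = "\<lambda>m x. path_fun (fst x) (real_of_int m / real (Suc k))"]) measurable
next
  fix x :: "path \<times> real"
  obtain w t where x: "x = (w, t)" by (cases x)
  have "(\<lambda>k. path_fun w (real_of_int \<lfloor>real (Suc k) * t\<rfloor> / real (Suc k))) \<longlonglongrightarrow> path_fun w t"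
  proof (cases "t \<ge> 0")
    case True
    then show ?thesis
      by (intro continuous_on_tendsto_compose[OF continuous_on_path floor_grid_tendsto])
        (auto intro!: always_eventually)
  next
    case False
    then have "real (Suc k) * t \<le> 0" for k
      by (intro mult_nonneg_nonpos) auto
    then have "\<lfloor>real (Suc k) * t\<rfloor> \<le> 0" for k
      by (metis floor_mono floor_zero)
    then have "path_fun w (real_of_int \<lfloor>real (Suc k) * t\<rfloor> / real (Suc k)) = 0" for k
      by (intro path_fun_nonpos divide_nonpos_nonneg) auto
    with False show ?thesis by (simp add: path_fun_nonpos)
  qed
  then show "(\<lambda>k. (case x of (w, t) \<Rightarrow> path_fun w (real_of_int \<lfloor>real (Suc k) * t\<rfloor> / real (Suc k))))
      \<longlonglongrightarrow> (case x of (w, t) \<Rightarrow> path_fun w t)"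
    by (simp add: x)
qed

lemma measurable_path_eval' [measurable (raw)]:
  assumes "g \<in> N \<rightarrow>\<^sub>M path_algebra" "s \<in> borel_measurable N"
  shows "(\<lambda>x. path_fun (g x) (s x)) \<in> borel_measurable N"
  using measurable_compose[OF measurable_Pair[OF assms] measurable_path_eval] by simp

lemma borel_measurable_path_fun [measurable]: "path_fun w \<in> borel_measurable borel"
proof -
  have "(\<lambda>_. w) \<in> (borel :: real measure) \<rightarrow>\<^sub>M path_algebra" by simp
  from measurable_path_eval'[OF this, of "\<lambda>x. x"] show ?thesis by simp
qed

lemma measurable_shift [measurable (raw)]:
  assumes [measurable]: "g \<in> N \<rightarrow>\<^sub>M path_algebra" "s \<in> borel_measurable N"
  shows "(\<lambda>x. g x + s x *\<^sub>R h) \<in> N \<rightarrow>\<^sub>M path_algebra"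
  by (rule measurable_path_algebraI) (simp add: plus_path.rep_eq scaleR_path.rep_eq)

lemma measurable_comp_sample:
  assumes "continuous_on {x. \<forall>i\<ge>n. x i = 0} f"
  shows "(\<lambda>(w, \<tau>). f (sample n t \<tau> w)) \<in> borel_measurable (path_algebra \<Otimes>\<^sub>M borel)"
proof -
  have "(\<lambda>x. sample n t (snd x) (fst x)) \<in> borel_measurable (path_algebra \<Otimes>\<^sub>M borel)"
    by (rule measurable_coordinatewise_then_product) (simp add: sample_def)
  then have "(\<lambda>x. sample n t (snd x) (fst x)) \<in>
      path_algebra \<Otimes>\<^sub>M borel \<rightarrow>\<^sub>M restrict_space borel {x. \<forall>i\<ge>n. x i = 0}"
    by (intro measurable_restrict_space2) (auto simp: sample_def)
  from measurable_compose[OF this borel_measurable_continuous_on_restrict[OF assms]]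
  show ?thesis by (simp add: split_beta')
qed

lemma measurable_cylinder:
  assumes "F \<in> cylinder_functions T"
  shows "F \<in> borel_measurable (path_algebra \<Otimes>\<^sub>M borel)"
  using assms
proof (rule cylinder_functionsE)
  fix n t f assume *: "smooth_bounded n f" "\<And>w \<tau>. F (w, \<tau>) = f (sample n t \<tau> w)"
  have "F = (\<lambda>(w, \<tau>). f (sample n t \<tau> w))" by (auto simp: *(2))
  then show ?thesis
    using measurable_comp_sample[OF smooth_bounded_continuous[OF *(1)]] by simp
qed

lemma measurable_dir_deriv:
  assumes "F \<in> cylinder_functions T"
  shows "dir_deriv h F \<in> borel_measurable (path_algebra \<Otimes>\<^sub>M borel)"
  using assms
proof (rule cylinder_functionsE)
  fix n t f assume *: "smooth_bounded n f" "\<And>w \<tau>. F (w, \<tau>) = f (sample n t \<tau> w)"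
  have "dir_deriv h F = (\<lambda>x. \<Sum>i<n. (case x of (w, \<tau>) \<Rightarrow> partial_deriv i f (sample n t \<tau> w)) *
      path_fun (cm_path h) (t i * snd x))"
    by (auto simp: dir_deriv_sample[OF *])
  also have "\<dots> \<in> borel_measurable (path_algebra \<Otimes>\<^sub>M borel)"
    by (intro borel_measurable_sum borel_measurable_times
        measurable_comp_sample[OF smooth_bounded_continuous_partial[OF *(1)]]) auto
  finally show ?thesis .
qed

section \<open>The Cameron--Martin theorem along the kernels\<close>

text \<open>Completing the square: tilting the centred normal density with variance \<open>\<sigma>\<^sup>2\<close> by
  \<open>exp (v x - v\<^sup>2 \<sigma>\<^sup>2 / 2)\<close> moves its mean to \<open>v \<sigma>\<^sup>2\<close>.\<close>

lemma nn_integral_normal_shift: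
  fixes g :: "real \<Rightarrow> ennreal"
  assumes \<sigma>: "0 < \<sigma>" and [measurable]: "g \<in> borel_measurable borel"
  shows "(\<integral>\<^sup>+x. normal_density 0 \<sigma> x * g (x + v * \<sigma>\<^sup>2) \<partial>lborel) =
    (\<integral>\<^sup>+x. normal_density 0 \<sigma> x * (exp (v * x - v\<^sup>2 * \<sigma>\<^sup>2 / 2) * g x) \<partial>lborel)"
proof -
  have dens: "normal_density 0 \<sigma> (v * \<sigma>\<^sup>2 + x) * exp (v * (v * \<sigma>\<^sup>2 + x) - v\<^sup>2 * \<sigma>\<^sup>2 / 2) = normal_density 0 \<sigma> x" for x
  proof -
    have "- (v * \<sigma>\<^sup>2 + x)\<^sup>2 / (2 * \<sigma>\<^sup>2) + (v * (v * \<sigma>\<^sup>2 + x) - v\<^sup>2 * \<sigma>\<^sup>2 / 2) = - x\<^sup>2 / (2 * \<sigma>\<^sup>2)"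
      using \<sigma> by (simp add: field_simps power2_eq_square)
    then show ?thesis
      by (simp add: normal_density_def exp_add[symmetric])
  qed
  have "(\<integral>\<^sup>+x. normal_density 0 \<sigma> x * (exp (v * x - v\<^sup>2 * \<sigma>\<^sup>2 / 2) * g x) \<partial>lborel) =
    (\<integral>\<^sup>+x. normal_density 0 \<sigma> (v * \<sigma>\<^sup>2 + 1 * x) *
      (exp (v * (v * \<sigma>\<^sup>2 + 1 * x) - v\<^sup>2 * \<sigma>\<^sup>2 / 2) * g (v * \<sigma>\<^sup>2 + 1 * x)) \<partial>lborel)"
    by (subst nn_integral_real_affine[where c = 1 and t = "v * \<sigma>\<^sup>2"]) auto
  also have "\<dots> = (\<integral>\<^sup>+x. normal_density 0 \<sigma> x * g (x + v * \<sigma>\<^sup>2) \<partial>lborel)"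
  proof (rule nn_integral_cong)
    fix x
    show "normal_density 0 \<sigma> (v * \<sigma>\<^sup>2 + 1 * x) *
        (exp (v * (v * \<sigma>\<^sup>2 + 1 * x) - v\<^sup>2 * \<sigma>\<^sup>2 / 2) * g (v * \<sigma>\<^sup>2 + 1 * x)) =
      normal_density 0 \<sigma> x * g (x + v * \<sigma>\<^sup>2)"
      unfolding dens[of x, symmetric] by (simp add: ennreal_mult mult.assoc add.commute)
  qed
  finally show ?thesis ..
qed

definition increment :: "(nat \<Rightarrow> real) \<Rightarrow> path \<Rightarrow> nat \<Rightarrow> real" where
  "increment t w i = path_fun w (t (Suc i)) - path_fun w (t i)"

lemma sum_increment:
  assumes "t 0 = 0"
  shows "(\<Sum>i<k. increment t w i) = path_fun w (t k)"
  unfolding increment_def by (subst sum_lessThan_telescope) (simp add: assms path_fun_nonpos)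

lemma measurable_increment [measurable]: "(\<lambda>w. increment t w i) \<in> borel_measurable path_algebra"
  unfolding increment_def by measurable

text \<open>The density of the law of \<open>w + u k\<^sub>b\<close> with respect to Wiener measure: the squared norm of the
  kernel is \<open>b\<close>, and the Wiener integral of its derivative is \<open>w(b)\<close>.\<close>

definition cm_density :: "real \<Rightarrow> real \<Rightarrow> path \<Rightarrow> real" where
  "cm_density b u w = exp (u * path_fun w b - u\<^sup>2 * b / 2)"

lemma measurable_cm_density [measurable]: "cm_density b u \<in> borel_measurable path_algebra"
  unfolding cm_density_def by measurable

locale wiener_space =
  fixes P :: "path measure"
  assumes P: "wiener_measure P"
begin

lemma prob_space_wiener: "prob_space P"
  using P by (simp add: wiener_measure_def)

lemma distributed_increment:
  "0 \<le> s \<Longrightarrow> s < t \<Longrightarrow>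
    distributed P lborel (\<lambda>w. path_fun w t - path_fun w s) (normal_density 0 (sqrt (t - s)))"
  using P by (simp add: wiener_measure_def)

lemma measurable_id_path_algebra [measurable]: "(\<lambda>w. w) \<in> P \<rightarrow>\<^sub>M path_algebra"
proof (rule measurable_path_algebraI)
  fix t show "(\<lambda>w. path_fun w t) \<in> borel_measurable P"
    using distributed_measurable[OF distributed_increment[of 0 t]]
    by (cases "t > 0") (simp_all add: path_fun_nonpos)
qed

lemma measurable_wiener_if_path_algebra:
  "f \<in> path_algebra \<rightarrow>\<^sub>M N \<Longrightarrow> f \<in> P \<rightarrow>\<^sub>M N"
  by (rule measurable_compose[OF measurable_id_path_algebra])

text \<open>The kernel has its kink at the grid point \<open>t\<^sub>m\<close>, so that every increment over the grid lies
  entirely on one side of the kink.\<close>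

context
  fixes n m :: nat and t :: "nat \<Rightarrow> real" and u :: real
  assumes t0: "t 0 = 0" and t: "strict_mono_on {..n} t" and m: "m \<le> n"
begin

lemma grid_less: "i < n \<Longrightarrow> t i < t (Suc i)"
  using t by (auto simp: strict_mono_on_def)

lemma grid_le: "i \<le> j \<Longrightarrow> j \<le> n \<Longrightarrow> t i \<le> t j"
  using strict_mono_on_leD[OF t, of i j] by auto

lemma grid_nonneg: "i \<le> n \<Longrightarrow> 0 \<le> t i"
  using grid_le[of 0 i] t0 by simp

lemma increment_min_path:
  assumes "i < n"
  shows "increment t (min_path (t m)) i = (if i < m then t (Suc i) - t i else 0)"
proof (cases "i < m")
  case True
  then show ?thesis
    using grid_le[of "Suc i" m] grid_le[of i m] grid_nonneg[of i] grid_nonneg[of "Suc i"] assms m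
    by (simp add: increment_def min_path.rep_eq)
next
  case False
  then show ?thesis
    using grid_le[of m i] grid_le[of m "Suc i"] grid_nonneg[of m] assms m
    by (simp add: increment_def min_path.rep_eq)
qed

text \<open>The density factorises over the increments, in accordance with their independence. An increment
  before \<open>t\<^sub>m\<close> is tilted by \<open>u\<close>, a later one not at all.\<close>

lemma cm_density_grid:
  "cm_density (t m) u w = (\<Prod>i<n. exp ((if i < m then u else 0) * increment t w i -
      (if i < m then u else 0)\<^sup>2 * (sqrt (t (Suc i) - t i))\<^sup>2 / 2))" (is "_ = ?r")
proof -
  have "?r = (\<Prod>i<n. exp (if i < m then u * increment t w i - u\<^sup>2 / 2 * (t (Suc i) - t i) else 0))"
    using grid_less by (intro prod.cong) (auto simp: less_imp_le)
  also have "\<dots> = exp (\<Sum>i<n. if i < m then u * increment t w i - u\<^sup>2 / 2 * (t (Suc i) - t i) else 0)"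
    by (simp add: exp_sum)
  also have "(\<Sum>i<n. if i < m then u * increment t w i - u\<^sup>2 / 2 * (t (Suc i) - t i) else 0) =
      (\<Sum>i<m. u * increment t w i - u\<^sup>2 / 2 * (t (Suc i) - t i))"
    using m by (intro sum.mono_neutral_cong_right) auto
  also have "\<dots> = u * (\<Sum>i<m. increment t w i) - u\<^sup>2 / 2 * (\<Sum>i<m. t (Suc i) - t i)"
    by (simp only: sum_distrib_left sum_subtractf[where f = "\<lambda>i. u * increment t w i"])
  also have "\<dots> = u * path_fun w (t m) - u\<^sup>2 / 2 * t m"
    by (simp only: sum_increment[of t, OF t0] sum_lessThan_telescope t0 diff_0_right)
  finally show ?thesis by (simp add: cm_density_def)
qed

text \<open>On increments before \<open>t\<^sub>m\<close> the kernel grows by exactly the variance of the Brownian increment.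
  Adding \<open>u\<close> times the kernel therefore moves the mean as tilting the normal density by \<open>u\<close> does, and
  independence turns the one-dimensional identities into one for products.\<close>

lemma cameron_martin_grid_product:
  fixes g :: "nat \<Rightarrow> real \<Rightarrow> ennreal"
  assumes g [measurable]: "\<And>i. i < n \<Longrightarrow> g i \<in> borel_measurable borel"
  shows "(\<integral>\<^sup>+w. (\<Prod>i<n. g i (increment t (w + u *\<^sub>R min_path (t m)) i)) \<partial>P) =
    (\<integral>\<^sup>+w. cm_density (t m) u w * (\<Prod>i<n. g i (increment t w i)) \<partial>P)"
proof -
  interpret prob_space P by (rule prob_space_wiener)
  define v where "v i = (if i < m then u else 0)" for i
  define \<sigma> where "\<sigma> i = sqrt (t (Suc i) - t i)" for i
  have \<sigma>: "0 < \<sigma> i" "(\<sigma> i)\<^sup>2 = t (Suc i) - t i" if "i < n" for i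
    using grid_less[OF that] by (auto simp: \<sigma>_def)
  have shift: "increment t (w + u *\<^sub>R min_path (t m)) i = increment t w i + v i * (\<sigma> i)\<^sup>2" if "i < n" for w i
  proof -
    have "increment t (w + u *\<^sub>R min_path (t m)) i = increment t w i + u * increment t (min_path (t m)) i"
      by (simp add: increment_def plus_path.rep_eq scaleR_path.rep_eq algebra_simps)
    then show ?thesis
      using increment_min_path[OF that] \<sigma>(2)[OF that] by (simp add: v_def)
  qed
  have indep: "indep_vars (\<lambda>_. borel) (\<lambda>i w. increment t w i) {..<n}"
    using P t t0 by (simp add: wiener_measure_def increment_def)
  have dist: "distributed P lborel (\<lambda>w. increment t w i) (normal_density 0 (\<sigma> i))" if "i < n" for i
    using distributed_increment[OF grid_nonneg grid_less[OF that]] that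
    by (simp add: increment_def \<sigma>_def)
  have "(\<integral>\<^sup>+w. (\<Prod>i<n. g i (increment t (w + u *\<^sub>R min_path (t m)) i)) \<partial>P) =
    (\<integral>\<^sup>+w. (\<Prod>i<n. g i (increment t w i + v i * (\<sigma> i)\<^sup>2)) \<partial>P)"
    by (intro nn_integral_cong prod.cong) (auto simp: shift)
  also have "\<dots> = (\<Prod>i<n. \<integral>\<^sup>+w. g i (increment t w i + v i * (\<sigma> i)\<^sup>2) \<partial>P)"
    by (intro indep_vars_nn_integral indep_vars_compose2[OF indep]) auto
  also have "\<dots> = (\<Prod>i<n. \<integral>\<^sup>+w. exp (v i * increment t w i - (v i)\<^sup>2 * (\<sigma> i)\<^sup>2 / 2) * g i (increment t w i) \<partial>P)"
  proof (intro prod.cong refl)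
    fix i assume "i \<in> {..<n}"
    then have i: "i < n" by simp
    show "(\<integral>\<^sup>+w. g i (increment t w i + v i * (\<sigma> i)\<^sup>2) \<partial>P) =
      (\<integral>\<^sup>+w. exp (v i * increment t w i - (v i)\<^sup>2 * (\<sigma> i)\<^sup>2 / 2) * g i (increment t w i) \<partial>P)"
      using nn_integral_normal_shift[OF \<sigma>(1)[OF i] g[OF i], of "v i"] i
      by (subst (1 2) distributed_nn_integral[OF dist[OF i], symmetric]) auto
  qed
  also have "\<dots> = (\<integral>\<^sup>+w. (\<Prod>i<n. exp (v i * increment t w i - (v i)\<^sup>2 * (\<sigma> i)\<^sup>2 / 2) * g i (increment t w i)) \<partial>P)"
    by (intro indep_vars_nn_integral[symmetric] indep_vars_compose2[OF indep]) auto
  also have "\<dots> = (\<integral>\<^sup>+w. cm_density (t m) u w * (\<Prod>i<n. g i (increment t w i)) \<partial>P)"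
    unfolding cm_density_grid v_def \<sigma>_def by (simp add: prod.distrib prod_ennreal)
  finally show ?thesis .
qed

text \<open>Products of indicators determine a finite measure on a finite product, so the product identity
  extends to all functions of the increments.\<close>

lemma cameron_martin_grid:
  fixes \<Psi> :: "(nat \<Rightarrow> real) \<Rightarrow> ennreal"
  assumes [measurable]: "\<Psi> \<in> borel_measurable (Pi\<^sub>M {..<n} (\<lambda>_. borel))"
  shows "(\<integral>\<^sup>+w. \<Psi> (restrict (increment t (w + u *\<^sub>R min_path (t m))) {..<n}) \<partial>P) =
    (\<integral>\<^sup>+w. cm_density (t m) u w * \<Psi> (restrict (increment t w) {..<n}) \<partial>P)"
proof -
  interpret prob_space P by (rule prob_space_wiener)
  let ?\<Pi> = "Pi\<^sub>M {..<n} (\<lambda>_. borel :: real measure)"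
  define I where "I w = restrict (increment t w) {..<n}" for w
  define S where "S w = w + u *\<^sub>R min_path (t m)" for w
  have [measurable]: "I \<in> path_algebra \<rightarrow>\<^sub>M ?\<Pi>"
    unfolding I_def by measurable
  have [measurable]: "S \<in> path_algebra \<rightarrow>\<^sub>M path_algebra"
    unfolding S_def by measurable
  have [measurable]: "I \<in> P \<rightarrow>\<^sub>M ?\<Pi>" "S \<in> P \<rightarrow>\<^sub>M path_algebra" "cm_density b u \<in> borel_measurable P" for b
    by (auto intro: measurable_wiener_if_path_algebra)
  have [measurable]: "(\<lambda>w. I (S w)) \<in> P \<rightarrow>\<^sub>M ?\<Pi>"
    by (rule measurable_compose[of S]) measurable
  define D where "D = density P (\<lambda>w. ennreal (cm_density (t m) u w))"
  have [measurable]: "I \<in> D \<rightarrow>\<^sub>M ?\<Pi>" by (simp add: D_def)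
  have "distr P ?\<Pi> (\<lambda>w. I (S w)) = distr D ?\<Pi> I"
  proof (rule measure_eqI_PiM_finite)
    fix A :: "nat \<Rightarrow> real set" assume A: "\<And>i. i \<in> {..<n} \<Longrightarrow> A i \<in> sets borel"
    then have [measurable]: "Pi\<^sub>E {..<n} A \<in> sets ?\<Pi>" by (intro sets_PiM_I_finite) auto
    have ind: "indicator (Pi\<^sub>E {..<n} A) (I w) = (\<Prod>i<n. indicator (A i) (increment t w i) :: ennreal)" for w
    proof -
      have "I w \<in> Pi\<^sub>E {..<n} A \<longleftrightarrow> (\<forall>i<n. increment t w i \<in> A i)"
        by (auto simp: I_def PiE_iff)
      then show ?thesis
        by (auto simp: indicator_def prod_zero_iff)
    qed
    have "emeasure (distr P ?\<Pi> (\<lambda>w. I (S w))) (Pi\<^sub>E {..<n} A) =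
        (\<integral>\<^sup>+w. indicator (Pi\<^sub>E {..<n} A) (I (S w)) \<partial>P)"
      by (subst nn_integral_indicator[symmetric], simp, subst nn_integral_distr) auto
    also have "\<dots> = (\<integral>\<^sup>+w. ennreal (cm_density (t m) u w) * indicator (Pi\<^sub>E {..<n} A) (I w) \<partial>P)"
      unfolding ind S_def by (rule cameron_martin_grid_product) (use A in auto)
    also have "\<dots> = (\<integral>\<^sup>+w. indicator (Pi\<^sub>E {..<n} A) (I w) \<partial>D)"
      unfolding D_def by (rule nn_integral_density[symmetric]) measurable
    also have "\<dots> = emeasure (distr D ?\<Pi> I) (Pi\<^sub>E {..<n} A)"
      by (subst nn_integral_indicator[symmetric], simp, subst nn_integral_distr) auto
    finally show "emeasure (distr P ?\<Pi> (\<lambda>w. I (S w))) (Pi\<^sub>E {..<n} A) = emeasure (distr D ?\<Pi> I) (Pi\<^sub>E {..<n} A)" .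
  next
    show "range (\<lambda>i::nat. space ?\<Pi>) \<subseteq> prod_algebra {..<n} (\<lambda>_. borel)"
      by (auto simp: space_PiM intro!: prod_algebraI_finite)
    show "emeasure (distr P ?\<Pi> (\<lambda>w. I (S w))) (space ?\<Pi>) \<noteq> \<infinity>" for i :: nat
      by (subst emeasure_distr) auto
  qed auto
  then have "(\<integral>\<^sup>+x. \<Psi> x \<partial>distr P ?\<Pi> (\<lambda>w. I (S w))) = (\<integral>\<^sup>+x. \<Psi> x \<partial>distr D ?\<Pi> I)"
    by simp
  then have "(\<integral>\<^sup>+w. \<Psi> (I (S w)) \<partial>P) = (\<integral>\<^sup>+w. \<Psi> (I w) \<partial>D)"
    by (simp add: nn_integral_distr)
  then show ?thesis
    by (simp add: D_def nn_integral_density) (simp add: I_def S_def)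
qed

end

lemma finite_grid:
  assumes J: "finite J" and J0: "\<And>x. x \<in> J \<Longrightarrow> 0 \<le> x" "0 \<in> J"
  shows "\<exists>(n::nat) (t :: nat \<Rightarrow> real). strict_mono_on {..n} t \<and> t ` {..n} = J \<and> t 0 = 0"
proof -
  define l where "l = sorted_list_of_set J"
  have l: "sorted_wrt (<) l" "set l = J"
    using J by (auto simp: l_def strict_sorted_list_of_set)
  have "l \<noteq> []" using l J0 by auto
  then obtain n where n: "length l = Suc n" by (cases l) auto
  have sm: "strict_mono_on {..n} (\<lambda>i. l ! i)"
    using sorted_wrt_nth_less[OF l(1)] n by (auto simp: strict_mono_on_def)
  have im: "(\<lambda>i. l ! i) ` {..n} = J"
    using l(2) n by (auto simp: set_conv_nth less_Suc_eq_le)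
  obtain k where k: "k \<le> n" "l ! k = 0" using im J0(2) by (metis (no_types) imageE atMost_iff)
  have "l ! 0 = 0"
  proof (cases "k = 0")
    case False
    then have "l ! 0 < 0" using strict_mono_onD[OF sm, of 0 k] k by simp
    moreover have "0 \<le> l ! 0" using J0(1) im by blast
    ultimately show ?thesis by simp
  qed (use k in simp)
  then show ?thesis using sm im by blast
qed

text \<open>Both laws are compared on finite-dimensional rectangles. Enlarging the finite set of times to a
  grid that contains \<open>0\<close> and \<open>b\<close> makes the evaluations sums of increments over that grid; negative
  times contribute the constant \<open>0\<close>.\<close>

lemma cameron_martin_path_measure:
  assumes b: "0 \<le> b"
  shows "distr P (Pi\<^sub>M UNIV (\<lambda>_. borel)) (\<lambda>w. path_fun (w + u *\<^sub>R min_path b)) =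
    distr (density P (\<lambda>w. ennreal (cm_density b u w))) (Pi\<^sub>M UNIV (\<lambda>_. borel)) path_fun"
proof (rule measure_eqI_PiM_infinite)
  interpret prob_space P by (rule prob_space_wiener)
  let ?\<Pi> = "Pi\<^sub>M UNIV (\<lambda>_. borel :: real measure) :: (real \<Rightarrow> real) measure"
  let ?S = "\<lambda>w. w + u *\<^sub>R min_path b"
  define D where "D = density P (\<lambda>w. ennreal (cm_density b u w))"
  have [measurable]: "path_fun \<in> P \<rightarrow>\<^sub>M ?\<Pi>"
    by (intro measurable_wiener_if_path_algebra measurable_path_fun_PiM)
  have [measurable]: "cm_density b u \<in> borel_measurable P"
    by (intro measurable_wiener_if_path_algebra) auto
  have [measurable]: "path_fun \<in> D \<rightarrow>\<^sub>M ?\<Pi>" by (simp add: D_def)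
  have "?S \<in> P \<rightarrow>\<^sub>M path_algebra"
    by (intro measurable_wiener_if_path_algebra) measurable
  then have [measurable]: "(\<lambda>w. path_fun (?S w)) \<in> P \<rightarrow>\<^sub>M ?\<Pi>"
    by (rule measurable_compose[OF _ measurable_path_fun_PiM])
  show "finite_measure (distr P ?\<Pi> (\<lambda>w. path_fun (?S w)))"
    by (intro finite_measure_distr) auto
  fix J :: "real set" and A :: "real \<Rightarrow> real set"
  assume J: "finite J" and A: "\<And>j. j \<in> J \<Longrightarrow> A j \<in> sets borel"
  have "\<exists>(n::nat) t. strict_mono_on {..n} t \<and> t ` {..n} = insert 0 (insert b (J \<inter> {0..})) \<and> t 0 = 0"
    by (rule finite_grid) (use J b in auto)
  then obtain n :: nat and t where t: "strict_mono_on {..n} t"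
      "t ` {..n} = insert 0 (insert b (J \<inter> {0..}))" "t 0 = 0"
    by blast
  have "b \<in> t ` {..n}" by (simp add: t)
  then obtain m where m: "m \<le> n" "t m = b" by auto
  have "\<forall>j\<in>J. \<exists>k. 0 \<le> j \<longrightarrow> k \<le> n \<and> t k = j"
  proof
    fix j assume "j \<in> J"
    then have "0 \<le> j \<longrightarrow> j \<in> t ` {..n}" by (simp add: t)
    then show "\<exists>k. 0 \<le> j \<longrightarrow> k \<le> n \<and> t k = j" by auto
  qed
  then obtain k where k: "\<And>j. j \<in> J \<Longrightarrow> 0 \<le> j \<Longrightarrow> k j \<le> n \<and> t (k j) = j"
    by (metis (no_types))
  define \<Psi> where "\<Psi> x = (\<Prod>j\<in>J. indicator (A j) (if 0 \<le> j then \<Sum>i<k j. x i else 0) :: ennreal)" for x :: "nat \<Rightarrow> real"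
  have [measurable]: "\<Psi> \<in> borel_measurable (Pi\<^sub>M {..<n} (\<lambda>_. borel))"
    unfolding \<Psi>_def
  proof (rule borel_measurable_prod_ennreal)
    fix j assume j: "j \<in> J"
    note [measurable] = A[OF j]
    have "(\<lambda>x. if 0 \<le> j then \<Sum>i<k j. x i else 0) \<in> borel_measurable (Pi\<^sub>M {..<n} (\<lambda>_. borel :: real measure))"
      using k[OF j] by (cases "0 \<le> j") (auto intro!: borel_measurable_sum measurable_component_singleton)
    then show "(\<lambda>x. indicator (A j) (if 0 \<le> j then \<Sum>i<k j. x i else 0) :: ennreal) \<in> borel_measurable (Pi\<^sub>M {..<n} (\<lambda>_. borel))"
      by (rule measurable_compose) simp
  qed
  let ?X = "prod_emb UNIV (\<lambda>_. borel) J (Pi\<^sub>E J A)"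
  have X [measurable]: "?X \<in> sets ?\<Pi>"
    using J A by (intro sets_PiM_I) auto
  have ind: "indicator ?X (path_fun w) = \<Psi> (restrict (increment t w) {..<n})" for w
  proof -
    have "(if 0 \<le> j then \<Sum>i<k j. restrict (increment t w) {..<n} i else 0) = path_fun w j" if "j \<in> J" for j
    proof (cases "0 \<le> j")
      case True
      then have "(\<Sum>i<k j. restrict (increment t w) {..<n} i) = (\<Sum>i<k j. increment t w i)"
        using k[OF that] by (intro sum.cong) auto
      with True k[OF that] show ?thesis by (simp add: sum_increment t)
    qed (simp add: path_fun_nonpos)
    then have "\<Psi> (restrict (increment t w) {..<n}) = (\<Prod>j\<in>J. indicator (A j) (path_fun w j))"
      unfolding \<Psi>_def by (intro prod.cong) auto
    moreover have "path_fun w \<in> ?X \<longleftrightarrow> (\<forall>j\<in>J. path_fun w j \<in> A j)"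
      by (auto simp: prod_emb_def PiE_iff space_PiM)
    ultimately show ?thesis
      using J by (auto simp: indicator_def prod_zero_iff)
  qed
  have "emeasure (distr P ?\<Pi> (\<lambda>w. path_fun (?S w))) ?X = (\<integral>\<^sup>+w. indicator ?X (path_fun (?S w)) \<partial>P)"
    by (subst nn_integral_indicator[symmetric], simp, subst nn_integral_distr) auto
  also have "\<dots> = (\<integral>\<^sup>+w. ennreal (cm_density b u w) * indicator ?X (path_fun w) \<partial>P)"
    unfolding ind m(2)[symmetric] by (rule cameron_martin_grid[OF t(3,1) m(1)]) simp
  also have "\<dots> = (\<integral>\<^sup>+w. indicator ?X (path_fun w) \<partial>D)"
    unfolding D_def by (rule nn_integral_density[symmetric]) measurable
  also have "\<dots> = emeasure (distr D ?\<Pi> path_fun) ?X"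
    by (subst nn_integral_indicator[symmetric], simp, subst nn_integral_distr) auto
  finally show "emeasure (distr P ?\<Pi> (\<lambda>w. path_fun (?S w))) ?X =
    emeasure (distr (density P (\<lambda>w. ennreal (cm_density b u w))) ?\<Pi> path_fun) ?X"
    by (simp add: D_def)
qed auto

text \<open>The Cameron--Martin theorem for the directions \<open>k\<^sub>b\<close>. It transfers from the product space because
  every set of \<open>path_algebra\<close> is the preimage of a product-measurable set under \<open>path_fun\<close>.\<close>

lemma cameron_martin:
  fixes f :: "path \<Rightarrow> ennreal"
  assumes b: "0 \<le> b" and f: "f \<in> borel_measurable path_algebra"
  shows "(\<integral>\<^sup>+w. f (w + u *\<^sub>R min_path b) \<partial>P) = (\<integral>\<^sup>+w. cm_density b u w * f w \<partial>P)"
proof -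
  let ?\<Pi> = "Pi\<^sub>M UNIV (\<lambda>_. borel :: real measure) :: (real \<Rightarrow> real) measure"
  let ?S = "\<lambda>w. w + u *\<^sub>R min_path b"
  define D where "D = density P (\<lambda>w. ennreal (cm_density b u w))"
  note [measurable] = f measurable_wiener_if_path_algebra[OF measurable_cm_density]
    measurable_wiener_if_path_algebra[OF f]
  have S [measurable]: "?S \<in> P \<rightarrow>\<^sub>M path_algebra"
    by (intro measurable_wiener_if_path_algebra) measurable
  have [measurable]: "(\<lambda>w. w) \<in> D \<rightarrow>\<^sub>M path_algebra" by (simp add: D_def)
  have "distr P path_algebra ?S = distr D path_algebra (\<lambda>w. w)"
  proof (rule measure_eqI)
    fix X assume X: "X \<in> sets (distr P path_algebra ?S)"
    then obtain Y where Y: "Y \<in> sets ?\<Pi>" "X = path_fun -` Y"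
      by (auto simp: path_algebra_def sets_vimage_algebra2 space_PiM)
    have "emeasure (distr P path_algebra ?S) X = emeasure (distr P ?\<Pi> (\<lambda>w. path_fun (?S w))) Y"
      using X Y measurable_compose[OF S measurable_path_fun_PiM]
      by (simp add: emeasure_distr vimage_def)
    also have "\<dots> = emeasure (distr D ?\<Pi> path_fun) Y"
      unfolding D_def by (simp add: cameron_martin_path_measure[OF b])
    also have "\<dots> = emeasure (distr D path_algebra (\<lambda>w. w)) X"
      using X Y measurable_compose[OF measurable_id_path_algebra measurable_path_fun_PiM]
      by (simp add: emeasure_distr D_def)
    finally show "emeasure (distr P path_algebra ?S) X = emeasure (distr D path_algebra (\<lambda>w. w)) X" .
  qed simp
  then have "(\<integral>\<^sup>+w. f w \<partial>distr P path_algebra ?S) = (\<integral>\<^sup>+w. f w \<partial>distr D path_algebra (\<lambda>w. w))"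
    by simp
  then show ?thesis
    by (simp add: nn_integral_distr D_def nn_integral_density)
qed

end

section \<open>Convergence in \<open>L\<^sup>p\<close> and in \<open>L\<^sup>1\<close>\<close>

lemma ennreal_tendsto_0I:
  fixes f :: "nat \<Rightarrow> ennreal"
  assumes "\<And>e :: real. 0 < e \<Longrightarrow> \<forall>\<^sub>F n in sequentially. f n \<le> ennreal e"
  shows "f \<longlonglongrightarrow> 0"
proof (rule order_tendstoI)
  fix a :: ennreal assume "0 < a"
  then obtain x where x: "0 < x" "x < a" using dense by blast
  then obtain e where e: "x = ennreal e" "0 < e" by (cases x) auto
  from assms[OF e(2)] show "\<forall>\<^sub>F n in sequentially. f n < a"
    by eventually_elim (use x e in auto)
qed simp

text \<open>If \<open>\<bar>x\<bar> > e\<close> then \<open>\<bar>x\<bar> / e \<le> (\<bar>x\<bar> / e)\<^sup>p\<close>. Letting \<open>e\<close> tend to \<open>0\<close> after integrating, this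
  gives convergence in \<open>L\<^sup>1\<close> from convergence in \<open>L\<^sup>p\<close> on a probability space.\<close>

lemma abs_le_powr:
  fixes x e p :: real
  assumes "0 < e" "1 \<le> p"
  shows "\<bar>x\<bar> \<le> e + e powr (1 - p) * \<bar>x\<bar> powr p"
proof (cases "\<bar>x\<bar> \<le> e")
  case True
  then show ?thesis using assms by (simp add: add_increasing2)
next
  case False
  then have "e powr (p - 1) \<le> \<bar>x\<bar> powr (p - 1)"
    using assms by (intro powr_mono2) auto
  then have "e powr (1 - p) * \<bar>x\<bar> * e powr (p - 1) \<le> e powr (1 - p) * \<bar>x\<bar> * \<bar>x\<bar> powr (p - 1)"
    by (intro mult_left_mono) auto
  also have "\<dots> = e powr (1 - p) * \<bar>x\<bar> powr p"
    using False assms powr_add[of "\<bar>x\<bar>" 1 "p - 1"] by (simp add: mult.assoc)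
  also have "e powr (1 - p) * \<bar>x\<bar> * e powr (p - 1) = \<bar>x\<bar>"
    using assms powr_add[of e "1 - p" "p - 1"] by simp
  finally show ?thesis using assms by simp
qed

lemma (in prob_space) nn_integral_abs_le_powr:
  fixes f :: "'a \<Rightarrow> real"
  assumes [measurable]: "f \<in> borel_measurable M" and e: "0 < e" and p: "1 \<le> p"
  shows "(\<integral>\<^sup>+x. ennreal \<bar>f x\<bar> \<partial>M) \<le> ennreal e + ennreal (e powr (1 - p)) * (\<integral>\<^sup>+x. ennreal (\<bar>f x\<bar> powr p) \<partial>M)"
proof -
  have "(\<integral>\<^sup>+x. ennreal \<bar>f x\<bar> \<partial>M) \<le>
      (\<integral>\<^sup>+x. ennreal e + ennreal (e powr (1 - p)) * ennreal (\<bar>f x\<bar> powr p) \<partial>M)"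
    using abs_le_powr[OF e p] e
    by (intro nn_integral_mono) (simp add: ennreal_mult[symmetric] ennreal_plus[symmetric] del: ennreal_plus)
  also have "\<dots> = ennreal e + ennreal (e powr (1 - p)) * (\<integral>\<^sup>+x. ennreal (\<bar>f x\<bar> powr p) \<partial>M)"
    by (simp add: nn_integral_add nn_integral_cmult emeasure_space_1)
  finally show ?thesis .
qed

lemma (in prob_space) L1_convergence_if_Lp:
  fixes f :: "nat \<Rightarrow> 'a \<Rightarrow> real"
  assumes f: "\<And>n. f n \<in> borel_measurable M" and p: "1 \<le> p"
    and lim: "(\<lambda>n. \<integral>\<^sup>+x. ennreal (\<bar>f n x\<bar> powr p) \<partial>M) \<longlonglongrightarrow> 0"
  shows "(\<lambda>n. \<integral>\<^sup>+x. ennreal \<bar>f n x\<bar> \<partial>M) \<longlonglongrightarrow> 0"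
proof (rule ennreal_tendsto_0I)
  fix e :: real assume e: "0 < e"
  have "(\<lambda>n. ennreal ((e/2) powr (1 - p)) * (\<integral>\<^sup>+x. ennreal (\<bar>f n x\<bar> powr p) \<partial>M)) \<longlonglongrightarrow>
      ennreal ((e/2) powr (1 - p)) * 0"
    by (intro ennreal_tendsto_cmult lim) simp
  then have "\<forall>\<^sub>F n in sequentially. ennreal ((e/2) powr (1 - p)) * (\<integral>\<^sup>+x. ennreal (\<bar>f n x\<bar> powr p) \<partial>M) < ennreal (e/2)"
    by (rule order_tendstoD) (use e in simp)
  then show "\<forall>\<^sub>F n in sequentially. (\<integral>\<^sup>+x. ennreal \<bar>f n x\<bar> \<partial>M) \<le> ennreal e"
  proof eventually_elim
    case (elim n)
    have "(\<integral>\<^sup>+x. ennreal \<bar>f n x\<bar> \<partial>M) \<le> ennreal (e/2) + ennreal (e/2)"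
      using nn_integral_abs_le_powr[OF f[of n] _ p, of "e/2"] e elim
      by (meson add_left_mono half_gt_zero less_imp_le order_trans)
    then show ?case using e by (simp add: ennreal_plus[symmetric] del: ennreal_plus)
  qed
qed

section \<open>Closability along one direction\<close>

lemma AE_lborel_ex_nonneg:
  assumes "AE s in lborel. Q (s::real)"
  shows "\<exists>s\<ge>0. Q s"
proof (rule ccontr)
  assume "\<not> ?thesis"
  with assms have "AE s in lborel. s \<notin> {0..1::real}"
    by (auto elim: eventually_mono)
  then have "{0..1::real} \<in> null_sets lborel"
    by (subst AE_iff_null_sets) auto
  then show False by (simp add: null_sets_def)
qed

text \<open>Only the shifts of the path matter in what follows, so the law of the time may be any
  probability measure \<open>L\<close>.\<close>

locale wiener_space_with_time = wiener_space P for P :: "path measure" +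
  fixes L :: "real measure"
  assumes L: "prob_space L" and L_borel: "(\<lambda>\<tau>. \<tau>) \<in> borel_measurable L"
begin

abbreviation "N \<equiv> P \<Otimes>\<^sub>M L"
abbreviation "Q \<equiv> path_algebra \<Otimes>\<^sub>M (borel :: real measure)"

lemma pair_prob_space_time: "pair_prob_space P L"
  using prob_space_wiener L
  by (simp add: pair_prob_space_def pair_sigma_finite_def prob_space_imp_sigma_finite)

lemma prob_space_N: "prob_space N"
proof -
  interpret pair_prob_space P L by (rule pair_prob_space_time)
  show ?thesis by unfold_locales
qed

lemma measurable_N_id: "(\<lambda>x. x) \<in> N \<rightarrow>\<^sub>M Q"
proof -
  have "(\<lambda>x. (fst x, snd x)) \<in> N \<rightarrow>\<^sub>M Q"
    by (intro measurable_Pair measurable_compose[OF measurable_fst measurable_id_path_algebra]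
        measurable_compose[OF measurable_snd L_borel])
  then show ?thesis by simp
qed

text \<open>The Cameron--Martin density is unbounded, so a shift does not preserve \<open>L\<^sup>1\<close>. It is bounded in
  terms of \<open>w(b)\<close>, however; restricting the integral to the event \<open>\<bar>w(b)\<bar> \<le> K\<close>, on which the shifted
  path is at most \<open>K + \<bar>u\<bar> b\<close> in absolute value at \<open>b\<close>, makes the shift bounded on \<open>L\<^sup>1\<close>.\<close>

lemma nn_integral_shift_le:
  fixes \<Phi> :: "path \<times> real \<Rightarrow> ennreal"
  assumes b: "0 \<le> b" and \<Phi> [measurable]: "\<Phi> \<in> borel_measurable Q"
  shows "(\<integral>\<^sup>+x. indicator {x. \<bar>path_fun (fst x) b\<bar> \<le> K} x * \<Phi> (fst x + u *\<^sub>R min_path b, snd x) \<partial>N)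
    \<le> ennreal (exp (\<bar>u\<bar> * (K + \<bar>u\<bar> * b))) * (\<integral>\<^sup>+x. \<Phi> x \<partial>N)"
proof -
  interpret pair_prob_space P L by (rule pair_prob_space_time)
  let ?h = "min_path b" and ?C = "exp (\<bar>u\<bar> * (K + \<bar>u\<bar> * b))"
  have hb: "path_fun ?h b = b" using b by (simp add: min_path.rep_eq)
  have slice: "(\<integral>\<^sup>+w. indicator {w. \<bar>path_fun w b\<bar> \<le> K} w * \<Phi> (w + u *\<^sub>R ?h, \<tau>) \<partial>P) \<le> ?C * (\<integral>\<^sup>+w. \<Phi> (w, \<tau>) \<partial>P)" for \<tau>
  proof -
    define g where "g w = indicator {w. \<bar>path_fun w b - u * b\<bar> \<le> K} w * \<Phi> (w, \<tau>)" for w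
    have [measurable]: "g \<in> borel_measurable path_algebra"
      unfolding g_def by measurable
    have "(\<integral>\<^sup>+w. indicator {w. \<bar>path_fun w b\<bar> \<le> K} w * \<Phi> (w + u *\<^sub>R ?h, \<tau>) \<partial>P) = (\<integral>\<^sup>+w. g (w + u *\<^sub>R ?h) \<partial>P)"
      by (intro nn_integral_cong) (auto simp: g_def indicator_def plus_path.rep_eq scaleR_path.rep_eq hb)
    also have "\<dots> = (\<integral>\<^sup>+w. cm_density b u w * g w \<partial>P)"
      by (rule cameron_martin[OF b]) measurable
    also have "\<dots> \<le> (\<integral>\<^sup>+w. ?C * \<Phi> (w, \<tau>) \<partial>P)"
    proof (rule nn_integral_mono)
      fix w
      show "cm_density b u w * g w \<le> ?C * \<Phi> (w, \<tau>)"
      proof (cases "\<bar>path_fun w b - u * b\<bar> \<le> K")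
        case True
        have "\<bar>path_fun w b\<bar> \<le> K + \<bar>u\<bar> * b"
          using True abs_triangle_ineq[of "path_fun w b - u * b" "u * b"] b by (simp add: abs_mult)
        then have "\<bar>u * path_fun w b\<bar> \<le> \<bar>u\<bar> * (K + \<bar>u\<bar> * b)"
          by (simp add: abs_mult mult_left_mono)
        moreover have "0 \<le> u\<^sup>2 * b / 2" using b by simp
        ultimately have "cm_density b u w \<le> ?C"
          unfolding cm_density_def by (subst exp_le_cancel_iff) linarith
        then show ?thesis
          by (auto simp: g_def indicator_def intro!: mult_right_mono ennreal_leI)
      qed (simp add: g_def)
    qed
    also have "\<dots> = ?C * (\<integral>\<^sup>+w. \<Phi> (w, \<tau>) \<partial>P)"
      by (intro nn_integral_cmult measurable_wiener_if_path_algebra) measurable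
    finally show ?thesis .
  qed
  have m [measurable]: "(\<lambda>x. indicator {x. \<bar>path_fun (fst x) b\<bar> \<le> K} x * \<Phi> (fst x + u *\<^sub>R ?h, snd x)) \<in> borel_measurable N"
    "\<Phi> \<in> borel_measurable N"
    by (rule measurable_compose[OF measurable_N_id], measurable)+
  have "(\<integral>\<^sup>+x. indicator {x. \<bar>path_fun (fst x) b\<bar> \<le> K} x * \<Phi> (fst x + u *\<^sub>R ?h, snd x) \<partial>N) =
    (\<integral>\<^sup>+\<tau>. \<integral>\<^sup>+w. indicator {w. \<bar>path_fun w b\<bar> \<le> K} w * \<Phi> (w + u *\<^sub>R ?h, \<tau>) \<partial>P \<partial>L)"
    unfolding nn_integral_snd[OF m(1), symmetric] by (simp add: indicator_def)
  also have "\<dots> \<le> (\<integral>\<^sup>+\<tau>. ?C * (\<integral>\<^sup>+w. \<Phi> (w, \<tau>) \<partial>P) \<partial>L)"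
    by (intro nn_integral_mono slice)
  also have "\<dots> = ?C * (\<integral>\<^sup>+\<tau>. (\<integral>\<^sup>+w. \<Phi> (w, \<tau>) \<partial>P) \<partial>L)"
    by (intro nn_integral_cmult) measurable
  also have "\<dots> = ?C * (\<integral>\<^sup>+x. \<Phi> x \<partial>N)"
    by (subst nn_integral_snd) auto
  finally show ?thesis .
qed

text \<open>Integrating \<open>G\<^sub>n\<close> along the line through \<open>x\<close> in the direction \<open>k\<^sub>b\<close>
  gives a difference of two values of \<open>F\<^sub>n\<close>. On the events \<open>\<bar>w(b)\<bar> \<le> K\<close> both sides converge in \<open>L\<^sup>1\<close>
  by \<open>nn_integral_shift_le\<close>, whence the integral of \<open>z\<close> over almost every line segment vanishes and
  \<open>z\<close> is zero at almost every point of almost every line. By Fubini there is one shift \<open>s\<close> for which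
  \<open>z(w + s k\<^sub>b, \<tau>)\<close> vanishes for almost all \<open>(w, \<tau>)\<close>, and the shift by \<open>- s\<close> preserves null
  sets.\<close>

lemma closable_direction:
  fixes F G :: "nat \<Rightarrow> path \<times> real \<Rightarrow> real" and z :: "path \<times> real \<Rightarrow> real"
  assumes b: "0 \<le> b"
    and F [measurable]: "\<And>n. F n \<in> borel_measurable Q"
    and G [measurable]: "\<And>n. G n \<in> borel_measurable Q"
    and z [measurable]: "z \<in> borel_measurable Q"
    and deriv: "\<And>n w \<tau> u. ((\<lambda>s. F n (w + s *\<^sub>R min_path b, \<tau>)) has_real_derivative
      G n (w + u *\<^sub>R min_path b, \<tau>)) (at u)"
    and cont: "\<And>n w \<tau>. continuous_on UNIV (\<lambda>s. G n (w + s *\<^sub>R min_path b, \<tau>))"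
    and F_lim: "(\<lambda>n. \<integral>\<^sup>+x. ennreal \<bar>F n x\<bar> \<partial>N) \<longlonglongrightarrow> 0"
    and G_lim: "(\<lambda>n. \<integral>\<^sup>+x. ennreal \<bar>G n x - z x\<bar> \<partial>N) \<longlonglongrightarrow> 0"
    and z_int: "(\<integral>\<^sup>+x. ennreal \<bar>z x\<bar> \<partial>N) < \<infinity>"
  shows "AE x in N. z x = 0"
proof -
  interpret N: prob_space N by (rule prob_space_N)
  interpret NL: pair_sigma_finite N lborel ..
  define S where "S s x = (fst x + s *\<^sub>R min_path b, snd x :: real)" for s and x :: "path \<times> real"
  define \<kappa> where "\<kappa> K x = (indicator {x. \<bar>path_fun (fst x) b\<bar> \<le> K} x :: ennreal)" for K and x :: "path \<times> real"
  define C where "C K u = exp (\<bar>u\<bar> * (K + \<bar>u\<bar> * b))" for K u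
  have S_meas [measurable]: "(\<lambda>y. S (s y) (f y)) \<in> M \<rightarrow>\<^sub>M Q"
    if [measurable]: "s \<in> borel_measurable M" "f \<in> M \<rightarrow>\<^sub>M Q" for s f M
    unfolding S_def by measurable
  have fstQ [measurable]: "(\<lambda>y. fst y) \<in> N \<Otimes>\<^sub>M lborel \<rightarrow>\<^sub>M Q"
    by (rule measurable_compose[OF measurable_fst measurable_N_id])
  have N_id [measurable]: "(\<lambda>x. x) \<in> N \<rightarrow>\<^sub>M Q" by (rule measurable_N_id)
  have N_meas: "f \<in> borel_measurable N" if "f \<in> borel_measurable Q" for f :: "path \<times> real \<Rightarrow> 'c :: topological_space"
    using measurable_compose[OF N_id that] by simp
  have \<kappa>Q [measurable]: "\<kappa> K \<in> borel_measurable Q" for K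
    unfolding \<kappa>_def by measurable
  have S_joint: "(\<lambda>y. f (S (snd y) (fst y))) \<in> borel_measurable (N \<Otimes>\<^sub>M lborel)"
    if "f \<in> borel_measurable Q" for f :: "path \<times> real \<Rightarrow> 'c :: topological_space"
    by (rule measurable_compose[OF S_meas that]) measurable
  have S_line: "(\<lambda>s. f (S s x)) \<in> borel_measurable borel"
    if "f \<in> borel_measurable Q" "x \<in> space N" for f :: "path \<times> real \<Rightarrow> 'c :: topological_space" and x
    using measurable_compose[OF measurable_Pair1'[of x N lborel] S_joint[OF that(1)]] that(2) by simp
  have shift: "(\<integral>\<^sup>+x. \<kappa> K x * \<Phi> (S u x) \<partial>N) \<le> C K u * (\<integral>\<^sup>+x. \<Phi> x \<partial>N)"
    if "\<Phi> \<in> borel_measurable Q" for \<Phi> K u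
    unfolding \<kappa>_def S_def C_def by (rule nn_integral_shift_le[OF b that])
  have shift_int: "(\<integral>\<^sup>+x. \<kappa> K x * (\<integral>\<^sup>+s. indicator {0..u} s * \<Phi> (S s x) \<partial>lborel) \<partial>N)
      \<le> ennreal (C K u) * ennreal u * (\<integral>\<^sup>+x. \<Phi> x \<partial>N)"
    if \<Phi> [measurable]: "\<Phi> \<in> borel_measurable Q" and u: "0 \<le> u" and K: "0 \<le> K" for \<Phi> :: "path \<times> real \<Rightarrow> ennreal" and K u
  proof -
    note [measurable] = S_joint[OF \<Phi>]
    have [measurable]: "(\<lambda>y. \<kappa> K (fst y)) \<in> borel_measurable (N \<Otimes>\<^sub>M lborel)"
      by (rule measurable_compose[OF fstQ]) measurable
    have "(\<integral>\<^sup>+x. \<kappa> K x * (\<integral>\<^sup>+s. indicator {0..u} s * \<Phi> (S s x) \<partial>lborel) \<partial>N) =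
        (\<integral>\<^sup>+x. \<integral>\<^sup>+s. indicator {0..u} s * (\<kappa> K x * \<Phi> (S s x)) \<partial>lborel \<partial>N)"
    proof (rule nn_integral_cong)
      fix x assume "x \<in> space N"
      then have [measurable]: "(\<lambda>s. \<Phi> (S s x)) \<in> borel_measurable borel" by (rule S_line[OF \<Phi>])
      show "\<kappa> K x * (\<integral>\<^sup>+s. indicator {0..u} s * \<Phi> (S s x) \<partial>lborel) =
          (\<integral>\<^sup>+s. indicator {0..u} s * (\<kappa> K x * \<Phi> (S s x)) \<partial>lborel)"
        by (subst nn_integral_cmult[symmetric]) (auto simp: ac_simps)
    qed
    also have "\<dots> = (\<integral>\<^sup>+s. \<integral>\<^sup>+x. indicator {0..u} s * (\<kappa> K x * \<Phi> (S s x)) \<partial>N \<partial>lborel)"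
      by (rule NL.Fubini'[symmetric]) (simp add: split_beta')
    also have "\<dots> \<le> (\<integral>\<^sup>+s. (C K u * (\<integral>\<^sup>+x. \<Phi> x \<partial>N)) * indicator {0..u} s \<partial>lborel)"
    proof (rule nn_integral_mono)
      fix s
      show "(\<integral>\<^sup>+x. indicator {0..u} s * (\<kappa> K x * \<Phi> (S s x)) \<partial>N) \<le> (C K u * (\<integral>\<^sup>+x. \<Phi> x \<partial>N)) * indicator {0..u} s"
      proof (cases "s \<in> {0..u}")
        case True
        then have "C K s \<le> C K u"
          unfolding C_def using b K by (auto intro!: mult_mono add_mono)
        then have "ennreal (C K s) * (\<integral>\<^sup>+x. \<Phi> x \<partial>N) \<le> C K u * (\<integral>\<^sup>+x. \<Phi> x \<partial>N)"
          by (intro mult_right_mono ennreal_leI) auto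
        with shift[OF \<Phi>, of K s] True show ?thesis by (auto intro: order_trans)
      qed simp
    qed
    also have "\<dots> = ennreal (C K u) * ennreal u * (\<integral>\<^sup>+x. \<Phi> x \<partial>N)"
      using u by (subst nn_integral_cmult_indicator) (auto simp: ac_simps)
    finally show ?thesis .
  qed
  have absz [measurable]: "(\<lambda>x. ennreal \<bar>z x\<bar>) \<in> borel_measurable Q" by measurable
  have zG [measurable]: "(\<lambda>x. ennreal \<bar>G n x - z x\<bar>) \<in> borel_measurable Q" for n by measurable
  have Fabs [measurable]: "(\<lambda>x. ennreal \<bar>F n x\<bar>) \<in> borel_measurable Q" for n by measurable
  \<comment> \<open>If \<open>z\<close> is not integrable on the segment, its Bochner integral is \<open>0\<close> by convention and the
    bound is trivial.\<close>
  have line_bound: "ennreal \<bar>LBINT s:{0..u}. z (S s x)\<bar> \<le> ennreal \<bar>F n (S u x)\<bar> + ennreal \<bar>F n x\<bar> +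
      (\<integral>\<^sup>+s. indicator {0..u} s * ennreal \<bar>G n (S s x) - z (S s x)\<bar> \<partial>lborel)"
    if x: "x \<in> space N" and u: "0 \<le> u" for n u x
  proof (cases "set_integrable lborel {0..u} (\<lambda>s. z (S s x))")
    case True
    have dF: "((\<lambda>s. F n (S s x)) has_real_derivative G n (S s x)) (at s)" for s
      unfolding S_def by (rule deriv)
    have cG: "continuous_on UNIV (\<lambda>s. G n (S s x))"
      unfolding S_def by (rule cont)
    have FTC: "has_bochner_integral lborel (\<lambda>s. G n (S s x) * indicator {0..u} s) (F n (S u x) - F n (S 0 x))"
      using cG by (intro has_bochner_integral_FTC_Icc_real u dF) (simp add: continuous_on_eq_continuous_at)
    have S0: "S 0 x = x" by (simp add: S_def)
    have Gi: "set_integrable lborel {0..u} (\<lambda>s. G n (S s x))"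
      using FTC by (simp add: set_integrable_def has_bochner_integral_iff mult.commute)
    have GI: "(LBINT s:{0..u}. G n (S s x)) = F n (S u x) - F n x"
      using FTC by (simp add: set_lebesgue_integral_def has_bochner_integral_iff S0 mult.commute)
    have "(LBINT s:{0..u}. z (S s x)) = (F n (S u x) - F n x) - (LBINT s:{0..u}. G n (S s x) - z (S s x))"
      using True Gi GI by simp
    then have "\<bar>LBINT s:{0..u}. z (S s x)\<bar> \<le> \<bar>F n (S u x)\<bar> + \<bar>F n x\<bar> + \<bar>LBINT s:{0..u}. G n (S s x) - z (S s x)\<bar>"
      by linarith
    then have "ennreal \<bar>LBINT s:{0..u}. z (S s x)\<bar> \<le>
        ennreal \<bar>F n (S u x)\<bar> + ennreal \<bar>F n x\<bar> + ennreal \<bar>LBINT s:{0..u}. G n (S s x) - z (S s x)\<bar>"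
      by (simp add: ennreal_plus[symmetric] del: ennreal_plus)
    also have "ennreal \<bar>LBINT s:{0..u}. G n (S s x) - z (S s x)\<bar> \<le>
        (\<integral>\<^sup>+s. norm (indicator {0..u} s *\<^sub>R (G n (S s x) - z (S s x))) \<partial>lborel)"
      unfolding set_lebesgue_integral_def real_norm_def[symmetric]
      using set_integral_diff(1)[OF Gi True]
      by (intro integral_norm_bound_ennreal) (simp add: set_integrable_def)
    also have "\<dots> = (\<integral>\<^sup>+s. indicator {0..u} s * ennreal \<bar>G n (S s x) - z (S s x)\<bar> \<partial>lborel)"
      by (intro nn_integral_cong) (auto simp: indicator_def)
    finally show ?thesis by (simp add: add_left_mono)
  next
    case False
    then have "(LBINT s:{0..u}. z (S s x)) = 0"
      unfolding set_lebesgue_integral_def set_integrable_def by (rule not_integrable_integral_eq)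
    then show ?thesis by simp
  qed
  have I_meas: "(\<lambda>x. LBINT s:{0..u}. z (S s x)) \<in> borel_measurable N" for u
  proof -
    note [measurable] = S_joint[OF z]
    show ?thesis
      unfolding set_lebesgue_integral_def
      by (rule lborel.borel_measurable_lebesgue_integral) (simp add: split_beta')
  qed
  have line_zero: "AE x in N. \<bar>path_fun (fst x) b\<bar> \<le> K \<longrightarrow> (LBINT s:{0..u}. z (S s x)) = 0"
    if u: "0 \<le> u" and K: "0 \<le> K" for u K
  proof -
    note [measurable] = I_meas[of u] N_meas[OF \<kappa>Q] N_meas[OF zG] N_meas[OF Fabs]
    let ?I = "\<lambda>x. ennreal \<bar>LBINT s:{0..u}. z (S s x)\<bar>"
    have bound: "(\<integral>\<^sup>+x. \<kappa> K x * ?I x \<partial>N) \<le> ennreal (C K u) * (\<integral>\<^sup>+x. ennreal \<bar>F n x\<bar> \<partial>N) + (\<integral>\<^sup>+x. ennreal \<bar>F n x\<bar> \<partial>N) +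
        ennreal (C K u) * ennreal u * (\<integral>\<^sup>+x. ennreal \<bar>G n x - z x\<bar> \<partial>N)" for n
    proof -
      let ?D = "\<lambda>x. \<integral>\<^sup>+s. indicator {0..u} s * ennreal \<bar>G n (S s x) - z (S s x)\<bar> \<partial>lborel"
      note [measurable] = S_joint[OF zG[of n]]
      have [measurable]: "?D \<in> borel_measurable N"
        by (rule lborel.borel_measurable_nn_integral) (simp add: split_beta')
      have [measurable]: "(\<lambda>x. ennreal \<bar>F n (S u x)\<bar>) \<in> borel_measurable N"
        by (rule N_meas) measurable
      have "(\<integral>\<^sup>+x. \<kappa> K x * ?I x \<partial>N) \<le>
          (\<integral>\<^sup>+x. \<kappa> K x * ennreal \<bar>F n (S u x)\<bar> + ennreal \<bar>F n x\<bar> + \<kappa> K x * ?D x \<partial>N)"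
      proof (rule nn_integral_mono)
        fix x assume "x \<in> space N"
        from line_bound[OF this u, of n]
        show "\<kappa> K x * ?I x \<le> \<kappa> K x * ennreal \<bar>F n (S u x)\<bar> + ennreal \<bar>F n x\<bar> + \<kappa> K x * ?D x"
          by (auto simp: \<kappa>_def indicator_def)
      qed
      also have "\<dots> = (\<integral>\<^sup>+x. \<kappa> K x * ennreal \<bar>F n (S u x)\<bar> \<partial>N) + (\<integral>\<^sup>+x. ennreal \<bar>F n x\<bar> \<partial>N) + (\<integral>\<^sup>+x. \<kappa> K x * ?D x \<partial>N)"
        by (simp add: nn_integral_add)
      also have "\<dots> \<le> ennreal (C K u) * (\<integral>\<^sup>+x. ennreal \<bar>F n x\<bar> \<partial>N) + (\<integral>\<^sup>+x. ennreal \<bar>F n x\<bar> \<partial>N) +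
          ennreal (C K u) * ennreal u * (\<integral>\<^sup>+x. ennreal \<bar>G n x - z x\<bar> \<partial>N)"
        by (intro add_mono order_refl shift[OF Fabs] shift_int[OF zG u K])
      finally show ?thesis .
    qed
    have "(\<lambda>n. ennreal (C K u) * (\<integral>\<^sup>+x. ennreal \<bar>F n x\<bar> \<partial>N) + (\<integral>\<^sup>+x. ennreal \<bar>F n x\<bar> \<partial>N) +
        ennreal (C K u) * ennreal u * (\<integral>\<^sup>+x. ennreal \<bar>G n x - z x\<bar> \<partial>N)) \<longlonglongrightarrow>
        ennreal (C K u) * 0 + 0 + ennreal (C K u) * ennreal u * 0"
      by (intro tendsto_add ennreal_tendsto_cmult F_lim G_lim) (auto simp: ennreal_mult_less_top)
    then have "(\<integral>\<^sup>+x. \<kappa> K x * ?I x \<partial>N) \<le> ennreal (C K u) * 0 + 0 + ennreal (C K u) * ennreal u * 0"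
      by (rule tendsto_lowerbound) (auto intro: always_eventually bound)
    then have "(\<integral>\<^sup>+x. \<kappa> K x * ?I x \<partial>N) = 0" by simp
    then have "AE x in N. \<kappa> K x * ?I x = 0"
      by (subst (asm) nn_integral_0_iff_AE) auto
    then show ?thesis
      by eventually_elim (auto simp: \<kappa>_def indicator_def)
  qed
  have line_int: "AE x in N. \<bar>path_fun (fst x) b\<bar> \<le> K \<longrightarrow> set_integrable lborel {0..u} (\<lambda>s. z (S s x))"
    if u: "0 \<le> u" and K: "0 \<le> K" for u K
  proof -
    note [measurable] = S_joint[OF absz] N_meas[OF \<kappa>Q]
    let ?D = "\<lambda>x. \<integral>\<^sup>+s. indicator {0..u} s * ennreal \<bar>z (S s x)\<bar> \<partial>lborel"
    have [measurable]: "?D \<in> borel_measurable N"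
      by (rule lborel.borel_measurable_nn_integral) (simp add: split_beta')
    have "ennreal (C K u) * ennreal u * (\<integral>\<^sup>+x. ennreal \<bar>z x\<bar> \<partial>N) < \<infinity>"
      using z_int by (simp add: ennreal_mult_less_top)
    with shift_int[OF absz u K] have "(\<integral>\<^sup>+x. \<kappa> K x * ?D x \<partial>N) \<noteq> \<infinity>"
      by (metis leD infinity_ennreal_def)
    then have "AE x in N. \<kappa> K x * ?D x \<noteq> \<infinity>"
      by (intro nn_integral_PInf_AE) auto
    with AE_space[of N] show ?thesis
    proof eventually_elim
      case (elim x)
      have [measurable]: "(\<lambda>s. z (S s x)) \<in> borel_measurable borel" by (rule S_line[OF z elim(1)])
      show ?case
      proof
        assume "\<bar>path_fun (fst x) b\<bar> \<le> K"
        with elim(2) have "?D x < \<infinity>" by (simp add: \<kappa>_def less_top)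
        also have "?D x = (\<integral>\<^sup>+s. norm (indicator {0..u} s *\<^sub>R z (S s x)) \<partial>lborel)"
          by (intro nn_integral_cong) (auto simp: indicator_def)
        finally show "set_integrable lborel {0..u} (\<lambda>s. z (S s x))"
          unfolding set_integrable_def by (intro integrableI_bounded) auto
      qed
    qed
  qed
  \<comment> \<open>Rational endpoints keep the exceptional sets countable; continuity in the endpoint fills in
    the rest.\<close>
  have "AE x in N. \<forall>K::nat. \<forall>u\<in>\<rat>. 0 \<le> u \<longrightarrow> \<bar>path_fun (fst x) b\<bar> \<le> real K \<longrightarrow> (LBINT s:{0..u}. z (S s x)) = 0"
    unfolding AE_all_countable
  proof
    fix K :: nat
    show "AE x in N. \<forall>u\<in>\<rat>. 0 \<le> u \<longrightarrow> \<bar>path_fun (fst x) b\<bar> \<le> real K \<longrightarrow> (LBINT s:{0..u}. z (S s x)) = 0"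
      by (subst AE_ball_countable[OF countable_rat]) (use line_zero[of _ "real K"] in auto)
  qed
  moreover have "AE x in N. \<forall>K u::nat. \<bar>path_fun (fst x) b\<bar> \<le> real K \<longrightarrow> set_integrable lborel {0..real u} (\<lambda>s. z (S s x))"
    unfolding AE_all_countable using line_int by auto
  ultimately have line: "AE x in N. AE s in lborel. 0 \<le> s \<longrightarrow> z (S s x) = 0"
  proof eventually_elim
    case (elim x)
    obtain K :: nat where K: "\<bar>path_fun (fst x) b\<bar> \<le> real K" using real_arch_simple by blast
    have int: "set_integrable lborel {0..u} (\<lambda>s. z (S s x))" for u
    proof -
      obtain m :: nat where m: "u \<le> real m" using real_arch_simple by blast
      show ?thesis
        by (rule set_integrable_subset[of _ "{0..real m}"]) (use elim(2) K m in auto)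
    qed
    show ?case
    proof (rule indefinite_integral_zero_AE[OF int])
      fix u :: real assume u: "0 \<le> u"
      have c: "continuous_on {0..m} (\<lambda>u. LBINT s:{0..u}. z (S s x))" for m
      proof -
        have "(LBINT s:{0..u}. z (S s x)) = integral {0..u} (\<lambda>s. z (S s x))" for u
          by (rule set_borel_integral_eq_integral(2)[OF int])
        then show ?thesis
          using indefinite_integral_continuous_1[OF set_borel_integral_eq_integral(1)[OF int[of m]]] by simp
      qed
      have "continuous_on {0..} (\<lambda>u. LBINT s:{0..u}. z (S s x))"
        unfolding continuous_on_eq_continuous_within
      proof
        fix v :: real assume v: "v \<in> {0..}"
        have "continuous (at v within {0..v + 1}) (\<lambda>u. LBINT s:{0..u}. z (S s x))"
          using c[of "v + 1"] v by (auto simp: continuous_on_eq_continuous_within)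
        moreover have "at v within {0..v + 1} = at v within {0..}"
          by (rule at_within_nhd[of _ "{..<v + 1}"]) auto
        ultimately show "continuous (at v within {0..}) (\<lambda>u. LBINT s:{0..u}. z (S s x))" by simp
      qed
      then show "(LBINT s:{0..u}. z (S s x)) = 0"
        by (rule continuous_zero_on_rationals) (use elim(1) K u in auto)
    qed
  qed
  have "{y \<in> space (N \<Otimes>\<^sub>M lborel). 0 \<le> snd y \<longrightarrow> z (S (snd y) (fst y)) = 0} \<in> sets (N \<Otimes>\<^sub>M lborel)"
    using S_joint[OF z] by measurable
  then have "AE s in lborel. AE x in N. 0 \<le> s \<longrightarrow> z (S s x) = 0"
    using NL.AE_commute[of "\<lambda>x s. 0 \<le> s \<longrightarrow> z (S s x) = 0"] line by simp
  then obtain s where s: "0 \<le> s" "AE x in N. z (S s x) = 0"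
    using AE_lborel_ex_nonneg by force
  \<comment> \<open>Shifting the null set \<open>{x. z (S s x) \<noteq> 0}\<close> back by \<open>- s\<close> gives the set where \<open>z\<close> itself is
    nonzero.\<close>
  define \<Phi> where "\<Phi> x = (indicator {x. z (S s x) \<noteq> 0} x :: ennreal)" for x
  have \<Phi> [measurable]: "\<Phi> \<in> borel_measurable Q"
    unfolding \<Phi>_def by measurable
  have "AE x in N. \<Phi> x = 0"
    using s(2) by eventually_elim (simp add: \<Phi>_def)
  then have \<Phi>0: "(\<integral>\<^sup>+x. \<Phi> x \<partial>N) = 0"
    using N_meas[OF \<Phi>] by (simp add: nn_integral_0_iff_AE)
  have "AE x in N. \<bar>path_fun (fst x) b\<bar> \<le> real K \<longrightarrow> z x = 0" for K
  proof -
    have "S s (S (- s) x) = x" for x by (simp add: S_def)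
    then have \<Phi>S: "\<Phi> (S (- s) x) = indicator {x. z x \<noteq> 0} x" for x
      by (simp add: \<Phi>_def indicator_def)
    have [measurable]: "(\<lambda>x. \<kappa> (real K) x * indicator {x. z x \<noteq> 0} x) \<in> borel_measurable N"
      by (rule N_meas) measurable
    have "(\<integral>\<^sup>+x. \<kappa> (real K) x * indicator {x. z x \<noteq> 0} x \<partial>N) = 0"
      using shift[OF \<Phi>, of "real K" "- s"] by (simp add: \<Phi>0 \<Phi>S)
    then have "AE x in N. \<kappa> (real K) x * indicator {x. z x \<noteq> 0} x = 0"
      by (subst (asm) nn_integral_0_iff_AE) auto
    then show ?thesis
      by eventually_elim (auto simp: \<kappa>_def indicator_def split: if_splits)
  qed
  then have "AE x in N. \<forall>K::nat. \<bar>path_fun (fst x) b\<bar> \<le> real K \<longrightarrow> z x = 0"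
    unfolding AE_all_countable by simp
  then show ?thesis
  proof eventually_elim
    case (elim x)
    obtain K :: nat where "\<bar>path_fun (fst x) b\<bar> \<le> real K" using real_arch_simple by blast
    with elim show ?case by blast
  qed
qed

end

section \<open>Closability of the gradient\<close>

text \<open>At \<open>s = 0\<close> the Laplace transform is the value \<open>1\<close> of the Mittag-Leffler function at \<open>0\<close>. A
  nonzero Bochner integral also shows that \<open>M\<close> is integrable.\<close>

lemma prob_space_time_law:
  assumes "M_density \<beta> M"
  shows "prob_space (time_law M)"
proof
  have meas [measurable]: "M \<in> borel_measurable (restrict_space lborel {0..})"
    and nonneg: "\<And>\<tau>. \<tau> \<ge> 0 \<Longrightarrow> 0 \<le> M \<tau>"
    and lap: "\<And>s. s \<ge> 0 \<Longrightarrow> (LBINT \<tau>:{0..}. exp (- s * \<tau>) * M \<tau>) = mittag_leffler \<beta> (- s)"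
    using assms by (auto simp: M_density_def)
  have "mittag_leffler \<beta> 0 = (\<Sum>n. inverse (Gamma (\<beta> * real n + 1)) * 0 ^ n)"
    by (simp add: mittag_leffler_def divide_inverse mult.commute)
  also have "\<dots> = 1"
    by (subst powser_zero) simp
  finally have 1: "(\<integral>\<tau>. indicator {0..} \<tau> * M \<tau> \<partial>lborel) = 1"
    using lap[of 0] by (simp add: set_lebesgue_integral_def)
  then have int: "integrable lborel (\<lambda>\<tau>. indicator {0..} \<tau> * M \<tau>)"
    using not_integrable_integral_eq by fastforce
  have "emeasure (time_law M) (space (time_law M)) =
      (\<integral>\<^sup>+\<tau>. ennreal (M \<tau>) \<partial>restrict_space lborel {0..})"
    unfolding time_law_def by (subst emeasure_density) (auto intro!: nn_integral_cong simp: space_restrict_space sets_restrict_space_iff)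
  also have "\<dots> = (\<integral>\<^sup>+\<tau>. ennreal (indicator {0..} \<tau> * M \<tau>) \<partial>lborel)"
    by (subst nn_integral_restrict_space) (auto intro!: nn_integral_cong simp: indicator_def)
  also have "\<dots> = 1"
    using nonneg 1 by (subst nn_integral_eq_integral[OF int]) (auto simp: indicator_def)
  finally show "emeasure (time_law M) (space (time_law M)) = 1" .
qed

text \<open>Functions measurable for the observed process live on times \<open>\<tau> \<ge> 0\<close>. Composing with
  \<open>\<bar>\<tau>\<bar>\<close> extends them measurably to all real times.\<close>

lemma measurable_abs_time: "(\<lambda>x. (fst x, \<bar>snd x\<bar>)) \<in> path_algebra \<Otimes>\<^sub>M borel \<rightarrow>\<^sub>M X_algebra T"
  unfolding X_algebra_def
proof (rule measurable_measure_of)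
  fix Y assume "Y \<in> {X_proc t -` B \<inter> (UNIV \<times> {0..}) | t B. t \<in> {0..T} \<and> B \<in> sets borel}"
  then obtain t B where Y: "Y = X_proc t -` B \<inter> (UNIV \<times> {0..})" and B: "B \<in> sets borel" by auto
  have "(\<lambda>x. path_fun (fst x) (t * \<bar>snd x\<bar>)) \<in> borel_measurable (path_algebra \<Otimes>\<^sub>M borel)"
    by measurable
  from measurable_sets[OF this B]
  show "(\<lambda>x. (fst x, \<bar>snd x\<bar>)) -` Y \<inter> space (path_algebra \<Otimes>\<^sub>M borel) \<in> sets (path_algebra \<Otimes>\<^sub>M (borel :: real measure))"
    by (rule back_subst[of "\<lambda>X. X \<in> _"]) (auto simp: Y X_proc_def)
qed auto

lemma measurable_ident_time_law: "(\<lambda>\<tau>. \<tau>) \<in> borel_measurable (time_law M)"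
proof -
  have sets: "sets (time_law M) = sets (restrict_space lborel {0::real..})"
    unfolding time_law_def by (rule sets_density)
  show ?thesis
    by (subst measurable_cong_sets[OF sets refl]) (rule measurable_restrict_space1, simp)
qed

theorem theorem4p5:
  fixes \<beta> T p q :: real
    and P :: "path measure" and M :: "real \<Rightarrow> real"
    and F :: "nat \<Rightarrow> path \<times> real \<Rightarrow> real"
    and Z :: "path \<times> real \<Rightarrow> cameron_martin"
  assumes "0 < \<beta>" and "\<beta> < 1" and "0 < T" and "1 \<le> p" and "1 \<le> q"
    and "wiener_measure P" and "M_density \<beta> M"
    and "\<And>n. F n \<in> cylinder_functions T"
    and "Z \<in> Lp_space p (P \<Otimes>\<^sub>M time_law M) (X_algebra T)"
    and "Lp_converges q (P \<Otimes>\<^sub>M time_law M) F (\<lambda>_. 0)"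
    and "Lp_converges p (P \<Otimes>\<^sub>M time_law M) (\<lambda>n. gradient (F n)) Z"
  shows "AE x in P \<Otimes>\<^sub>M time_law M. Z x = 0"
proof -
  note P = assms(6) and F = assms(8)
  let ?L = "time_law M"
  have L: "prob_space ?L" by (rule prob_space_time_law) fact
  interpret W: wiener_space_with_time P ?L
    using P L measurable_ident_time_law
    by (simp add: wiener_space_with_time_def wiener_space_def wiener_space_with_time_axioms_def)
  define N where "N = P \<Otimes>\<^sub>M ?L"
  define Q where "Q = path_algebra \<Otimes>\<^sub>M (borel :: real measure)"
  interpret N: prob_space N unfolding N_def by (rule W.prob_space_N)
  have N_meas: "f \<in> N \<rightarrow>\<^sub>M R" if "f \<in> Q \<rightarrow>\<^sub>M R" for f :: "path \<times> real \<Rightarrow> 'c" and R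
    using measurable_compose[OF W.measurable_N_id that[unfolded Q_def]]
    by (simp add: N_def)
  obtain Z' where Z': "Z' \<in> borel_measurable (X_algebra T)" "AE x in N. Z x = Z' x"
      "(\<integral>\<^sup>+x. ennreal (norm (Z' x) powr p) \<partial>N) < \<infinity>"
    using assms(9) unfolding Lp_space_def N_def by blast
  define Y where "Y x = Z' (fst x, \<bar>snd x\<bar>)" for x
  have Y [measurable]: "Y \<in> borel_measurable Q"
    unfolding Y_def Q_def by (rule measurable_compose[OF measurable_abs_time Z'(1)])
  have YZ': "Y x = Z' x" if "x \<in> space N" for x
    using that by (auto simp: Y_def N_def space_pair_measure time_law_def space_restrict_space)
  have ZY: "AE x in N. Z x = Y x"
    using Z'(2) AE_space[of N] by eventually_elim (simp add: YZ')
  have Y_int: "(\<integral>\<^sup>+x. ennreal (norm (Y x) powr p) \<partial>N) < \<infinity>"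
    using Z'(3) by (simp add: YZ' cong: nn_integral_cong)
  have "AE x in N. inner (cm_kernel b) (Y x) = 0" if b: "0 < b" for b
  proof -
    let ?k = "cm_kernel b"
    define z where "z x = inner ?k (Y x)" for x
    define G where "G n = dir_deriv ?k (F n)" for n
    have z [measurable]: "z \<in> borel_measurable Q"
      unfolding z_def
      by (rule measurable_compose[OF Y borel_measurable_continuous_onI]) (intro continuous_intros)
    have Fm [measurable]: "F n \<in> borel_measurable Q" for n
      unfolding Q_def by (rule measurable_cylinder[OF F])
    have Gm [measurable]: "G n \<in> borel_measurable Q" for n
      unfolding Q_def G_def by (rule measurable_dir_deriv[OF F])
    \<comment> \<open>The summand \<open>1\<close> keeps \<open>c\<close> positive, so that it can be divided out below. The function \<open>V\<close>
      in \<open>dom\<close> is not known to be measurable, which is why the constant is moved past the integral of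
      \<open>f\<close> and not past that of \<open>V\<close>.\<close>
    define c where "c = norm ?k powr p + 1"
    have c: "0 < c" unfolding c_def by (rule add_nonneg_pos) auto
    have k: "\<bar>inner ?k v\<bar> powr p / c \<le> norm v powr p" for v
    proof -
      have "\<bar>inner ?k v\<bar> powr p \<le> norm ?k powr p * norm v powr p"
        using Cauchy_Schwarz_ineq2[of ?k v] \<open>1 \<le> p\<close>
        by (subst powr_mult[symmetric]) (auto intro!: powr_mono2)
      also have "\<dots> \<le> c * norm v powr p"
        unfolding c_def by (intro mult_right_mono) auto
      finally show ?thesis using c by (simp add: field_simps)
    qed
    have dom: "(\<integral>\<^sup>+x. ennreal (\<bar>f x\<bar> powr p) \<partial>N) \<le> ennreal c * (\<integral>\<^sup>+x. ennreal (norm (V x) powr p) \<partial>N)"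
      if f: "f \<in> borel_measurable Q" and V: "AE x in N. f x = inner ?k (V x)" for f V
    proof -
      note [measurable] = N_meas[OF f]
      have "(\<integral>\<^sup>+x. ennreal (\<bar>f x\<bar> powr p) \<partial>N) = (\<integral>\<^sup>+x. ennreal c * ennreal (\<bar>f x\<bar> powr p / c) \<partial>N)"
        using c by (simp add: ennreal_mult[symmetric])
      also have "\<dots> = ennreal c * (\<integral>\<^sup>+x. ennreal (\<bar>f x\<bar> powr p / c) \<partial>N)"
        by (rule nn_integral_cmult) measurable
      also have "\<dots> \<le> ennreal c * (\<integral>\<^sup>+x. ennreal (norm (V x) powr p) \<partial>N)"
        by (intro mult_left_mono nn_integral_mono_AE, use V in eventually_elim) (auto intro!: ennreal_leI k)
      finally show ?thesis .
    qed
    have F_lim: "(\<lambda>n. \<integral>\<^sup>+x. ennreal \<bar>F n x\<bar> \<partial>N) \<longlonglongrightarrow> 0"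
      using assms(10) by (intro N.L1_convergence_if_Lp[OF N_meas[OF Fm] \<open>1 \<le> q\<close>]) (simp add: Lp_converges_def N_def)
    have Gz: "AE x in N. G n x - z x = inner ?k (gradient (F n) x - Z x)" for n
      using ZY by eventually_elim (simp add: G_def z_def inner_gradient[OF F, symmetric] inner_diff_right inner_commute)
    have "(\<lambda>n. \<integral>\<^sup>+x. ennreal (\<bar>G n x - z x\<bar> powr p) \<partial>N) \<longlonglongrightarrow> 0"
    proof (rule tendsto_sandwich[of "\<lambda>_. 0" _ _
          "\<lambda>n. ennreal c * (\<integral>\<^sup>+x. ennreal (norm (gradient (F n) x - Z x) powr p) \<partial>N)"])
      have "(\<lambda>n. ennreal c * (\<integral>\<^sup>+x. ennreal (norm (gradient (F n) x - Z x) powr p) \<partial>N)) \<longlonglongrightarrow>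
          ennreal c * 0"
        using assms(11) by (intro ennreal_tendsto_cmult) (simp_all add: Lp_converges_def N_def)
      then show "(\<lambda>n. ennreal c * (\<integral>\<^sup>+x. ennreal (norm (gradient (F n) x - Z x) powr p) \<partial>N)) \<longlonglongrightarrow> 0"
        by simp
    qed (auto intro!: always_eventually dom Gz borel_measurable_diff Gm z)
    then have G_lim: "(\<lambda>n. \<integral>\<^sup>+x. ennreal \<bar>G n x - z x\<bar> \<partial>N) \<longlonglongrightarrow> 0"
      by (intro N.L1_convergence_if_Lp[OF N_meas \<open>1 \<le> p\<close>]) measurable
    have "(\<integral>\<^sup>+x. ennreal (\<bar>z x\<bar> powr p) \<partial>N) < \<infinity>"
      using dom[OF z, of Y] Y_int by (auto simp: z_def ennreal_mult_less_top intro: le_less_trans)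
    then have z_int: "(\<integral>\<^sup>+x. ennreal \<bar>z x\<bar> \<partial>N) < \<infinity>"
      using N.nn_integral_abs_le_powr[OF N_meas[OF z], of 1 p] \<open>1 \<le> p\<close> by (auto intro: le_less_trans)
    have "AE x in N. z x = 0"
    proof (rule W.closable_direction[of b F G z, folded N_def Q_def])
      show "((\<lambda>s. F n (w + s *\<^sub>R min_path b, \<tau>)) has_real_derivative G n (w + u *\<^sub>R min_path b, \<tau>)) (at u)" for n w \<tau> u
        using cylinder_has_derivative[OF F, of n w ?k \<tau> u] by (simp add: G_def cm_kernel.rep_eq)
      show "continuous_on UNIV (\<lambda>s. G n (w + s *\<^sub>R min_path b, \<tau>))" for n w \<tau>
        using continuous_dir_deriv[OF F, of ?k n w \<tau>] by (simp add: G_def cm_kernel.rep_eq)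
    qed (use b F_lim G_lim z_int in auto)
    then show ?thesis by (simp add: z_def)
  qed
  then have "AE x in N. \<forall>b\<in>\<rat>. 0 < b \<longrightarrow> inner (cm_kernel b) (Y x) = 0"
    by (subst AE_ball_countable[OF countable_rat]) auto
  with ZY have "AE x in N. Z x = 0"
    by eventually_elim (auto intro: cameron_martin_eq_0I)
  then show ?thesis unfolding N_def .
qed

end
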